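(* Let $x,y\in\mathbb{M}_n(\mathbb{C})$ be positive semidefinite matrices and let $|||\cdot|||$ be a unitarily invariant norm on $\mathbb{M}_n(\mathbb{C})$. If $t\in[0,\frac14]\cup[\frac34,1]$, then $$|||x^{t}y^{1-t}+y^{t}x^{1-t}|||\leq|||x+y|||.$$
   Context: $\mathbb{M}_n(\mathbb{C})$ is the space of $n\times n$ complex matrices. A norm $|||\cdot|||$ on $\mathbb{M}_n(\mathbb{C})$ is unitarily invariant if $|||UAV|||=|||A|||$ for all $A\in\mathbb{M}_n(\mathbb{C})$ and all unitary $U,V\in\mathbb{M}_n(\mathbb{C})$. Powers of positive semidefinite matrices are given by functional calculus. *)

theory Defs
  imports "HOL-Analysis.Analysis"
begin

definition ctranspose :: "complex^'n^'m \<Rightarrow> complex^'m^'n" where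
  "ctranspose A = map_matrix cnj (transpose A)"

definition unitary_matrix :: "complex^'n^'n \<Rightarrow> bool" where
  "unitary_matrix U \<longleftrightarrow> ctranspose U ** U = mat 1 \<and> U ** ctranspose U = mat 1"

definition hermitian_matrix :: "complex^'n^'n \<Rightarrow> bool" where
  "hermitian_matrix A \<longleftrightarrow> ctranspose A = A"

definition psd_matrix :: "complex^'n^'n \<Rightarrow> bool" where
  "psd_matrix A \<longleftrightarrow> hermitian_matrix A \<and>
     (\<forall>v. (\<Sum>i\<in>UNIV. cnj (v $ i) * (A *v v) $ i) \<in> \<real>\<^sub>\<ge>\<^sub>0)"

definition diag_matrix :: "real^'n \<Rightarrow> complex^'n^'n" where
  "diag_matrix d = (\<chi> i j. if i = j then complex_of_real (d $ i) else 0)"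

(* Functional calculus of a Hermitian matrix. The value does not depend on the
   diagonalization (lemma matrix_fun_diag below); for a matrix that is not Hermitian
   there is no diagonalization of this form and the value is unspecified. *)
definition matrix_fun :: "(real \<Rightarrow> real) \<Rightarrow> complex^'n^'n \<Rightarrow> complex^'n^'n" where
  "matrix_fun f A = (THE B. \<exists>U d. unitary_matrix U \<and>
     A = U ** diag_matrix d ** ctranspose U \<and>
     B = U ** diag_matrix (\<chi> i. f (d $ i)) ** ctranspose U)"

(* The case distinction gives 0^0 = 1, hence A^0 = I also for singular A;
   in HOL, 0 powr 0 = 0. *)
definition matrix_powr :: "complex^'n^'n \<Rightarrow> real \<Rightarrow> complex^'n^'n" where
  "matrix_powr A t = matrix_fun (\<lambda>s. if t = 0 then 1 else s powr t) A"

definition matrix_norm :: "(complex^'n^'n \<Rightarrow> real) \<Rightarrow> bool" where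
  "matrix_norm N \<longleftrightarrow>
     (\<forall>A. 0 \<le> N A) \<and>
     (\<forall>A. N A = 0 \<longleftrightarrow> A = 0) \<and>
     (\<forall>c A. N (map_matrix ((*) c) A) = cmod c * N A) \<and>
     (\<forall>A B. N (A + B) \<le> N A + N B)"

definition unitarily_invariant_norm :: "(complex^'n^'n \<Rightarrow> real) \<Rightarrow> bool" where
  "unitarily_invariant_norm N \<longleftrightarrow> matrix_norm N \<and>
     (\<forall>A U V. unitary_matrix U \<and> unitary_matrix V \<longrightarrow> N (U ** A ** V) = N A)"

lemma diag_matrix_mult_right:
  "(W ** diag_matrix d) $ i $ j = W $ i $ j * complex_of_real (d $ j)"
  by (simp add: matrix_matrix_mult_def diag_matrix_def if_distrib cong: if_cong)

lemma diag_matrix_mult_left: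
  "(diag_matrix d ** W) $ i $ j = complex_of_real (d $ i) * W $ i $ j"
proof -
  have "(diag_matrix d ** W) $ i $ j =
      (\<Sum>k\<in>UNIV. if k = i then complex_of_real (d $ i) * W $ k $ j else 0)"
    unfolding matrix_matrix_mult_def diag_matrix_def vec_lambda_beta
    by (intro sum.cong) auto
  then show ?thesis by simp
qed

lemma matrix_fun_diag:
  assumes U: "unitary_matrix U"
  shows "matrix_fun f (U ** diag_matrix d ** ctranspose U) =
    U ** diag_matrix (\<chi> i. f (d $ i)) ** ctranspose U"
  unfolding matrix_fun_def
proof (rule the_equality)
  show "\<exists>U' d'. unitary_matrix U' \<and>
      U ** diag_matrix d ** ctranspose U = U' ** diag_matrix d' ** ctranspose U' \<and>
      U ** diag_matrix (\<chi> i. f (d $ i)) ** ctranspose U =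
        U' ** diag_matrix (\<chi> i. f (d' $ i)) ** ctranspose U'"
    using U by blast
next
  fix B
  assume "\<exists>V e. unitary_matrix V \<and>
      U ** diag_matrix d ** ctranspose U = V ** diag_matrix e ** ctranspose V \<and>
      B = V ** diag_matrix (\<chi> i. f (e $ i)) ** ctranspose V"
  then obtain V e where V: "unitary_matrix V"
    and eq: "U ** diag_matrix d ** ctranspose U = V ** diag_matrix e ** ctranspose V"
    and B: "B = V ** diag_matrix (\<chi> i. f (e $ i)) ** ctranspose V"
    by blast
  define W where "W = ctranspose V ** U"
  have VV: "ctranspose V ** V = mat 1" "V ** ctranspose V = mat 1"
    and UU: "ctranspose U ** U = mat 1" "U ** ctranspose U = mat 1"
    using U V by (auto simp: unitary_matrix_def)
  have "W ** diag_matrix d =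
      ctranspose V ** (U ** diag_matrix d ** ctranspose U) ** U"
    by (simp add: W_def matrix_mul_assoc[symmetric] UU(1))
  also have "\<dots> = diag_matrix e ** W"
    by (simp add: eq W_def matrix_mul_assoc VV(1))
  finally have WD: "W ** diag_matrix d = diag_matrix e ** W" .
  have "W $ i $ j * complex_of_real (f (d $ j)) = complex_of_real (f (e $ i)) * W $ i $ j"
    for i j
  proof -
    have "W $ i $ j * complex_of_real (d $ j) = complex_of_real (e $ i) * W $ i $ j"
      using arg_cong[OF WD, of "\<lambda>M. M $ i $ j"]
      by (simp only: diag_matrix_mult_left diag_matrix_mult_right)
    then have "W $ i $ j = 0 \<or> d $ j = e $ i"
      by (simp add: mult.commute)
    then show ?thesis by auto
  qed
  then have WF: "W ** diag_matrix (\<chi> i. f (d $ i)) = diag_matrix (\<chi> i. f (e $ i)) ** W"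
    by (simp add: vec_eq_iff diag_matrix_mult_left diag_matrix_mult_right)
  have "B = V ** (diag_matrix (\<chi> i. f (e $ i)) ** W) ** ctranspose U"
    by (simp add: B W_def matrix_mul_assoc[symmetric] UU(2))
  also have "\<dots> = U ** diag_matrix (\<chi> i. f (d $ i)) ** ctranspose U"
    by (simp add: WF[symmetric]) (simp add: W_def matrix_mul_assoc VV(2))
  finally show "B = U ** diag_matrix (\<chi> i. f (d $ i)) ** ctranspose U" .
qed

end

theory Submission
  imports Defs
begin

text \<open>
  Write \<open>T\<close> for the matrix on the left and \<open>M = (x + y) / 2\<close>. Replacing \<open>t\<close> by \<open>1 - t\<close> turns
  \<open>T\<close> into its adjoint, which has the same norm, so let \<open>0 < t \<le> 1/4\<close>; at \<open>t = 0\<close> both sides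
  agree. Let \<open>T = W X\<close> be a polar decomposition. Splitting
  \<open>y powr (1 - t) = y powr (1/2 - t) y powr (1/2)\<close>, and likewise for \<open>x\<close>, the Cauchy--Schwarz
  inequality gives \<open>X \<le> (W* S W + x + y) / 2\<close> in the Loewner order, where
  \<open>S = x powr t y powr (1 - 2 t) x powr t + y powr t x powr (1 - 2 t) y powr t\<close>.

  For commuting matrices \<open>S \<le> x + y\<close> is Young's inequality for each summand, but the
  bounds \<open>2 t x + (1 - 2 t) y\<close> and \<open>2 t y + (1 - 2 t) x\<close> of the summands are not
  symmetric. Adding \<open>(1/2 - 2 t) (x - y)\<close> to the first summand and subtracting it from the second
  does not change \<open>S\<close> and makes both bounds equal to \<open>M\<close>. In this corrected form the
  bound survives without commutativity in the sense of eigenvalues: the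
  \<open>j\<close>-th largest eigenvalue of
  \<open>x powr t y powr (1 - 2 t) x powr t + (1/2 - 2 t) (x - y)\<close> is at most that of \<open>M\<close>
  (\<open>qform_corrected_half_le\<close>, through \<open>eigenvalues_dominated\<close>). The reason is that for
  each threshold \<open>\<mu>\<close> the form of this matrix is at most \<open>\<mu>\<close> on the vectors that
  \<open>x powr t\<close> maps into the spectral subspace of \<open>M\<close> below \<open>\<mu>\<close>.

  Hence each corrected half lies below a unitary conjugate of \<open>M\<close>
  (\<open>corrected_half_le_unitary_conj\<close>), so that \<open>X\<close> lies below an average of
  unitary conjugates of \<open>x + y\<close>. A unitarily invariant norm is monotone on
  positive semidefinite matrices (\<open>unitarily_invariant_norm_psd_mono\<close>), and the norm of the average
  is at most the norm of \<open>x + y\<close>.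
\<close>

section \<open>The sesquilinear form and unitary matrices\<close>

definition cinner :: "complex^'n \<Rightarrow> complex^'n \<Rightarrow> complex" where
  "cinner v w = (\<Sum>i\<in>UNIV. cnj (v $ i) * w $ i)"

definition qform :: "complex^'n^'n \<Rightarrow> complex^'n \<Rightarrow> real" where
  "qform A v = Re (cinner v (A *v v))"

lemma cinner_add_right: "cinner v (w + z) = cinner v w + cinner v z"
  by (simp add: cinner_def distrib_left sum.distrib)

lemma cinner_add_left: "cinner (w + z) v = cinner w v + cinner z v"
  by (simp add: cinner_def distrib_right sum.distrib)

lemma cinner_diff_right: "cinner v (w - z) = cinner v w - cinner v z"
  by (simp add: cinner_def right_diff_distrib sum_subtractf)

lemma cinner_diff_left: "cinner (w - z) v = cinner w v - cinner z v"
  by (simp add: cinner_def left_diff_distrib sum_subtractf)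

lemma cinner_scale_right: "cinner v (c *s w) = c * cinner v w"
  by (simp add: cinner_def sum_distrib_left algebra_simps)

lemma cinner_scale_left: "cinner (c *s v) w = cnj c * cinner v w"
  by (simp add: cinner_def sum_distrib_left algebra_simps)

lemma cinner_commute: "cinner v w = cnj (cinner w v)"
  by (simp add: cinner_def mult.commute)

lemma cinner_self: "cinner v v = complex_of_real ((norm v)\<^sup>2)"
proof -
  have "(norm v)\<^sup>2 = (\<Sum>i\<in>UNIV. (cmod (v $ i))\<^sup>2)"
    by (simp add: norm_vec_def L2_set_def sum_nonneg)
  then show ?thesis
    by (simp add: cinner_def complex_norm_square mult.commute del: of_real_power)
qed

lemma norm_power2_sum: "(norm (v :: complex^'n))\<^sup>2 = (\<Sum>i\<in>UNIV. (cmod (v $ i))\<^sup>2)"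
  by (simp add: norm_vec_def L2_set_def sum_nonneg)

lemma ctranspose_nth [simp]: "ctranspose A $ i $ j = cnj (A $ j $ i)"
  by (simp add: ctranspose_def transpose_def map_matrix_def)

lemma ctranspose_ctranspose [simp]: "ctranspose (ctranspose A) = A"
  by (simp add: vec_eq_iff)

lemma ctranspose_mult: "ctranspose (A ** B) = ctranspose B ** ctranspose A"
  by (simp add: vec_eq_iff matrix_matrix_mult_def mult.commute)

lemma ctranspose_add: "ctranspose (A + B) = ctranspose A + ctranspose B"
  by (simp add: vec_eq_iff)

lemma ctranspose_diag [simp]: "ctranspose (diag_matrix d) = diag_matrix d"
  by (simp add: vec_eq_iff diag_matrix_def)

lemma ctranspose_mat_1 [simp]: "ctranspose (mat 1) = mat 1"
  by (simp add: vec_eq_iff mat_def)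

lemma cinner_adjoint: "cinner (A *v v) w = cinner v (ctranspose A *v w)"
proof -
  have "cinner (A *v v) w = (\<Sum>i\<in>UNIV. \<Sum>j\<in>UNIV. cnj (A$i$j) * cnj (v$j) * w$i)"
    by (simp add: cinner_def matrix_vector_mult_def sum_distrib_right)
  also have "\<dots> = (\<Sum>j\<in>UNIV. \<Sum>i\<in>UNIV. cnj (A$i$j) * cnj (v$j) * w$i)"
    by (rule sum.swap)
  also have "\<dots> = cinner v (ctranspose A *v w)"
    by (simp add: cinner_def matrix_vector_mult_def sum_distrib_left algebra_simps)
  finally show ?thesis .
qed

lemma unitary_adjoint: "unitary_matrix U \<Longrightarrow> unitary_matrix (ctranspose U)"
  by (simp add: unitary_matrix_def)

lemma unitary_mult:
  assumes U: "unitary_matrix U" and V: "unitary_matrix V"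
  shows "unitary_matrix (U ** V)"
proof -
  have "ctranspose V ** ctranspose U ** (U ** V) = ctranspose V ** (ctranspose U ** U) ** V"
    "U ** V ** (ctranspose V ** ctranspose U) = U ** (V ** ctranspose V) ** ctranspose U"
    by (simp_all add: matrix_mul_assoc)
  then show ?thesis
    using U V by (simp add: unitary_matrix_def ctranspose_mult)
qed

lemma unitary_mat_1: "unitary_matrix (mat 1)"
  by (simp add: unitary_matrix_def)

lemma unitary_norm:
  assumes "unitary_matrix U"
  shows "norm (U *v v) = norm v"
proof -
  have "cinner (U *v v) (U *v v) = cinner v v"
    using assms by (simp add: cinner_adjoint matrix_vector_mul_assoc unitary_matrix_def)
  then have "(norm (U *v v))\<^sup>2 = (norm v)\<^sup>2"
    unfolding cinner_self of_real_eq_iff .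
  then show ?thesis by simp
qed

lemma cinner_scaleR_right: "cinner v (r *\<^sub>R w) = r * cinner v w"
  unfolding cinner_def vector_scaleR_component sum_distrib_left
  by (intro sum.cong) (simp_all add: scaleR_conv_of_real)

lemma cinner_scaleR_left: "cinner (r *\<^sub>R v) w = r * cinner v w"
  unfolding cinner_def vector_scaleR_component sum_distrib_left
  by (intro sum.cong) (simp_all add: scaleR_conv_of_real)

lemma matrix_vector_scaleR: "(A :: complex^'n^'m) *v (r *\<^sub>R v) = r *\<^sub>R (A *v v)"
  by (simp add: vec_eq_iff matrix_vector_mult_def scaleR_sum_right)

lemma qform_add_scaleR:
  assumes "hermitian_matrix A"
  shows "qform A (w + r *\<^sub>R z) = qform A w + 2 * r * Re (cinner z (A *v w)) + r\<^sup>2 * qform A z"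
proof -
  have "cinner w (A *v z) = cnj (cinner z (A *v w))"
    using assms cinner_commute[of w "A *v z"] cinner_adjoint[of A z w]
    by (simp add: hermitian_matrix_def)
  then show ?thesis
    by (simp add: qform_def matrix_vector_right_distrib matrix_vector_scaleR cinner_add_left
        cinner_add_right cinner_scaleR_left cinner_scaleR_right power2_eq_square algebra_simps)
qed

lemma qform_scaleR: "qform A (r *\<^sub>R v) = r\<^sup>2 * qform A v"
  by (simp add: qform_def matrix_vector_scaleR cinner_scaleR_left cinner_scaleR_right
      power2_eq_square)

lemma continuous_on_cinner: "continuous_on S (cinner v)"
  unfolding cinner_def[abs_def] by (intro continuous_intros)

lemma continuous_on_qform: "continuous_on S (qform A)"
  unfolding qform_def[abs_def] cinner_def matrix_vector_mult_def
  by (simp, intro continuous_intros)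

lemma qform_add: "qform (A + B) v = qform A v + qform B v"
  by (simp add: qform_def matrix_vector_mult_add_rdistrib cinner_add_right)

lemma qform_scaleR_matrix: "qform (r *\<^sub>R A) v = r * qform A v"
proof -
  have "(r *\<^sub>R A) *v v = r *\<^sub>R (A *v v)"
    by (simp add: vec_eq_iff matrix_vector_mult_def scaleR_sum_right)
  then show ?thesis by (simp add: qform_def cinner_scaleR_right)
qed

lemma qform_diff: "qform (A - B) v = qform A v - qform B v"
  by (simp add: qform_def matrix_vector_mult_diff_rdistrib cinner_diff_right)

lemma qform_conj: "qform (K ** A ** ctranspose K) v = qform A (ctranspose K *v v)"
  using cinner_adjoint[of "ctranspose K" v "A *v (ctranspose K *v v)"]
  by (simp add: qform_def matrix_vector_mul_assoc matrix_mul_assoc)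

lemma hermitian_add: "hermitian_matrix A \<Longrightarrow> hermitian_matrix B \<Longrightarrow> hermitian_matrix (A + B)"
  by (simp add: hermitian_matrix_def ctranspose_add)

lemma ctranspose_scaleR: "ctranspose (r *\<^sub>R A) = r *\<^sub>R ctranspose A"
  by (simp add: vec_eq_iff)

lemma hermitian_scaleR: "hermitian_matrix A \<Longrightarrow> hermitian_matrix (r *\<^sub>R A)"
  by (simp add: hermitian_matrix_def ctranspose_scaleR)

lemma hermitian_diff: "hermitian_matrix A \<Longrightarrow> hermitian_matrix B \<Longrightarrow> hermitian_matrix (A - B)"
  by (simp add: hermitian_matrix_def vec_eq_iff)

lemma hermitian_conj: "hermitian_matrix A \<Longrightarrow> hermitian_matrix (K ** A ** ctranspose K)"
  by (simp add: hermitian_matrix_def ctranspose_mult matrix_mul_assoc)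

lemma psd_hermitian: "psd_matrix A \<Longrightarrow> hermitian_matrix A"
  by (simp add: psd_matrix_def)

lemma psd_iff_qform: "psd_matrix A \<longleftrightarrow> hermitian_matrix A \<and> (\<forall>v. 0 \<le> qform A v)"
proof -
  have "cinner v (A *v v) \<in> \<real>\<^sub>\<ge>\<^sub>0 \<longleftrightarrow> 0 \<le> qform A v" if "hermitian_matrix A" for v
  proof -
    have "cinner v (A *v v) = cnj (cinner v (A *v v))"
      using that cinner_adjoint[of A v v] cinner_commute[of v "A *v v"] by (simp add: hermitian_matrix_def)
    then have "Im (cinner v (A *v v)) = 0"
      by (metis Reals_cnj_iff complex_is_Real_iff)
    then show ?thesis by (simp add: qform_def complex_nonneg_Reals_iff)
  qed
  then show ?thesis by (auto simp: psd_matrix_def cinner_def[symmetric])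
qed

lemma psd_add: "psd_matrix A \<Longrightarrow> psd_matrix B \<Longrightarrow> psd_matrix (A + B)"
  by (simp add: psd_iff_qform hermitian_add qform_add)

lemma psd_scaleR: "0 \<le> r \<Longrightarrow> psd_matrix A \<Longrightarrow> psd_matrix (r *\<^sub>R A)"
  by (simp add: psd_iff_qform hermitian_scaleR qform_scaleR_matrix)

lemma psd_conj: "psd_matrix A \<Longrightarrow> psd_matrix (K ** A ** ctranspose K)"
  by (simp add: psd_iff_qform hermitian_conj qform_conj)

section \<open>The spectral theorem\<close>

text \<open>
  Writing the equations into rows of a square matrix, numbered by indices in \<open>A\<close>, leaves at
  least one zero row, so the determinant vanishes and the kernel is nontrivial. Unit vectors
  in the rows outside \<open>A\<close> force the remaining coordinates to be zero.
\<close>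

lemma homogeneous_system:
  fixes L :: "'b \<Rightarrow> complex^'n"
  assumes "finite B" and "card B < card (A::'n set)"
  shows "\<exists>z. z \<noteq> 0 \<and> (\<forall>i. i \<notin> A \<longrightarrow> z $ i = 0) \<and> (\<forall>b\<in>B. (\<Sum>i\<in>UNIV. L b $ i * z $ i) = 0)"
proof -
  obtain f where f: "f ` B \<subseteq> A" "inj_on f B"
    using card_le_inj[of B A] assms by auto
  have "card (f ` B) < card A"
    using assms card_image[OF f(2)] by simp
  then have "f ` B \<noteq> A" by auto
  then obtain k where k: "k \<in> A" "k \<notin> f ` B"
    using f(1) by auto
  define K :: "complex^'n^'n" where
    "K = (\<chi> i. if i \<in> f ` B then L (the_inv_into B f i) else if i \<in> A then 0 else axis i 1)"
  have "row k K = 0"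
    using k by (simp add: row_def K_def vec_eq_iff)
  then have "det K = 0"
    by (rule det_zero_row(2))
  then have "\<not> invertible K"
    by (simp add: invertible_det_nz)
  then obtain z where z: "z \<noteq> 0" "K *v z = 0"
    using invertible_left_inverse matrix_left_invertible_ker by blast
  have row: "(\<Sum>j\<in>UNIV. K $ i $ j * z $ j) = 0" for i
    using arg_cong[OF z(2), of "\<lambda>v. v $ i"] by (simp add: matrix_vector_mult_def)
  have "z $ i = 0" if "i \<notin> A" for i
  proof -
    have "K $ i = axis i 1"
      using that f(1) by (auto simp: K_def)
    then have "K $ i $ j * z $ j = (if j = i then z $ i else 0)" for j
      by (simp add: axis_def)
    then show ?thesis using row[of i] by simp
  qed
  moreover have "(\<Sum>i\<in>UNIV. L b $ i * z $ i) = 0" if "b \<in> B" for b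
    using row[of "f b"] that the_inv_into_f_f[OF f(2) that] by (simp add: K_def)
  ultimately show ?thesis using z(1) by blast
qed

text \<open>
  The maximizer \<open>w\<close> of the quadratic form over the unit sphere of the orthogonal
  complement of \<open>S\<close> is an eigenvector. That complement is invariant under \<open>A\<close>, so the
  residual \<open>r = A w - l w\<close> lies in it, and moving from \<open>w\<close> a little in the direction
  of \<open>r\<close> would increase the form at first order unless \<open>r = 0\<close>.
\<close>

lemma hermitian_orthogonal_eigenvector:
  fixes A :: "complex^'n^'n"
  assumes A: "hermitian_matrix A" and S: "finite S" "card S < CARD('n)"
    and eig: "\<And>v. v \<in> S \<Longrightarrow> \<exists>\<mu>. A *v v = \<mu> *s v"
  shows "\<exists>w l. norm w = 1 \<and> (\<forall>v\<in>S. cinner v w = 0) \<and> A *v w = l *\<^sub>R w"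
proof -
  define K where "K = sphere 0 1 \<inter> (\<Inter>v\<in>S. {w. cinner v w = 0})"
  have inK: "(1 / norm z) *\<^sub>R z \<in> K" if "z \<noteq> 0" "\<forall>v\<in>S. cinner v z = 0" for z
    using that by (simp add: K_def cinner_scaleR_right)
  have "compact K"
    unfolding K_def
    by (intro compact_Int_closed compact_sphere closed_INT ballI closed_Collect_eq
        continuous_on_cinner continuous_on_const)
  moreover have "K \<noteq> {}"
  proof -
    obtain z where "z \<noteq> 0" "\<forall>v\<in>S. (\<Sum>i\<in>UNIV. (\<chi> i. cnj (v $ i)) $ i * z $ i) = 0"
      using homogeneous_system[OF S(1), of UNIV "\<lambda>v. \<chi> i. cnj (v $ i)"] S(2) by auto
    then have "(1 / norm z) *\<^sub>R z \<in> K"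
      by (intro inK) (auto simp: cinner_def)
    then show ?thesis by auto
  qed
  ultimately obtain w where w: "w \<in> K" and max: "\<And>v. v \<in> K \<Longrightarrow> qform A v \<le> qform A w"
    using continuous_attains_sup[OF _ _ continuous_on_qform] by metis
  define l where "l = qform A w"
  define B where "B = A - mat (complex_of_real l)"
  have Bv: "B *v v = A *v v - l *\<^sub>R v" for v
    by (simp add: B_def matrix_vector_mult_diff_rdistrib vec_eq_iff)
      (simp add: mat_def matrix_vector_mult_def if_distrib[where f="\<lambda>x. x * _"] scaleR_conv_of_real[where 'a=complex]
        cong: if_cong)
  have B: "hermitian_matrix B"
    using A by (auto simp: B_def hermitian_matrix_def vec_eq_iff mat_def)
  have qB: "qform B v = qform A v - l * (norm v)\<^sup>2" for v
    by (simp add: qform_def Bv cinner_diff_right cinner_scaleR_right cinner_self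
        del: of_real_power of_real_mult flip: of_real_mult)
  have le: "qform B v \<le> 0" if "\<forall>u\<in>S. cinner u v = 0" for v
  proof (cases "v = 0")
    case True
    then show ?thesis by (simp add: qform_def cinner_def)
  next
    case False
    have "qform A ((1 / norm v) *\<^sub>R v) \<le> l"
      unfolding l_def by (intro max inK False that)
    then show ?thesis
      using False by (simp add: qform_scaleR qB power_divide field_simps)
  qed
  have w1: "norm w = 1" and wS: "\<forall>v\<in>S. cinner v w = 0"
    using w by (auto simp: K_def)
  define r where "r = B *v w"
  have rS: "\<forall>v\<in>S. cinner v r = 0"
  proof
    fix v assume v: "v \<in> S"
    obtain \<mu> where "A *v v = \<mu> *s v" using eig[OF v] by blast
    then have "cinner v (A *v w) = cnj \<mu> * cinner v w"
      using A cinner_adjoint[of A v w] by (simp add: hermitian_matrix_def cinner_scale_left)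
    then show "cinner v r = 0"
      using wS v by (simp add: r_def Bv cinner_diff_right cinner_scaleR_right)
  qed
  have "r = 0"
  proof (rule ccontr)
    assume "r \<noteq> 0"
    then have pos: "(norm r)\<^sup>2 > 0" by simp
    \<comment> \<open>a step so short that the first-order gain beats the second-order term\<close>
    define c where "c = (norm r)\<^sup>2 / (\<bar>qform B r\<bar> + 1)"
    have c: "c > 0" using pos by (simp add: c_def)
    have "qform B (w + c *\<^sub>R r) \<le> 0"
      using wS rS by (intro le) (simp add: cinner_add_right cinner_scaleR_right)
    moreover have "qform B w = 0"
      by (simp add: qB w1 l_def)
    ultimately have "2 * c * (norm r)\<^sup>2 + c\<^sup>2 * qform B r \<le> 0"
      using qform_add_scaleR[OF B, of w c r] by (simp add: r_def[symmetric] cinner_self del: of_real_power)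
    then have "c * (2 * (norm r)\<^sup>2 + c * qform B r) \<le> 0"
      by (simp add: power2_eq_square algebra_simps)
    then have "2 * (norm r)\<^sup>2 + c * qform B r \<le> 0"
      using c by (simp add: mult_le_0_iff)
    moreover have "c * \<bar>qform B r\<bar> \<le> (norm r)\<^sup>2"
    proof -
      have "c * (\<bar>qform B r\<bar> + 1) = (norm r)\<^sup>2" by (simp add: c_def)
      then show ?thesis using c by (simp add: algebra_simps)
    qed
    moreover have "- (c * \<bar>qform B r\<bar>) \<le> c * qform B r"
      using c by (metis abs_ge_minus_self minus_le_iff mult_le_cancel_left_pos mult_minus_right)
    ultimately show False using pos by linarith
  qed
  then have "A *v w = l *\<^sub>R w"
    by (simp add: r_def Bv)
  then show ?thesis using w1 wS by blast
qed

theorem hermitian_diagonalizable: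
  fixes A :: "complex^'n^'n"
  assumes A: "hermitian_matrix A"
  obtains U d where "unitary_matrix U" "A = U ** diag_matrix d ** ctranspose U"
proof -
  have "\<exists>e d. (\<forall>i\<in>I. norm (e i) = 1 \<and> A *v e i = d i *\<^sub>R e i) \<and>
      (\<forall>i\<in>I. \<forall>j\<in>I. i \<noteq> j \<longrightarrow> cinner (e i) (e j) = 0)" for I :: "'n set"
  proof (induction I rule: finite_induct[OF finite])
    case 1
    then show ?case by simp
  next
    case (2 k I)
    from 2(3) obtain e d where e: "\<forall>i\<in>I. norm (e i) = 1 \<and> A *v e i = d i *\<^sub>R e i"
      "\<forall>i\<in>I. \<forall>j\<in>I. i \<noteq> j \<longrightarrow> cinner (e i) (e j) = 0"
      by (elim exE conjE) (rule that)
    have "card (e ` I) \<le> card I" by (rule card_image_le) simp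
    also have "card I < CARD('n)"
      using 2(2) by (intro psubset_card_mono) auto
    finally have card: "card (e ` I) < CARD('n)" .
    have eig: "\<exists>\<mu>. A *v v = \<mu> *s v" if "v \<in> e ` I" for v
    proof -
      from that obtain i where "i \<in> I" "v = e i" by blast
      then have "A *v v = complex_of_real (d i) *s v"
        using e(1) \<open>i \<in> I\<close>
        by (auto simp: vec_eq_iff[of _ "_ *s _"] scaleR_conv_of_real[where 'a=complex])
      then show ?thesis by blast
    qed
    have "\<exists>w l. norm w = 1 \<and> (\<forall>v\<in>e ` I. cinner v w = 0) \<and> A *v w = l *\<^sub>R w"
      by (rule hermitian_orthogonal_eigenvector[OF A finite_imageI[OF finite] card]) (rule eig)
    then obtain w l where w: "norm w = 1" "\<forall>v\<in>e ` I. cinner v w = 0" "A *v w = l *\<^sub>R w"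
      by (elim exE conjE) (rule that)
    have w': "cinner w (e i) = 0" if "i \<in> I" for i
      using w(2) that cinner_commute[of w "e i"] by simp
    show ?case
      by (rule exI[of _ "e(k := w)"], rule exI[of _ "d(k := l)"]) (use e w w' 2(2) in auto)
  qed
  from this[of UNIV] obtain e d where
    "\<forall>i\<in>UNIV :: 'n set. norm (e i) = 1 \<and> A *v e i = d i *\<^sub>R e i"
    "\<forall>i\<in>UNIV. \<forall>j\<in>UNIV. i \<noteq> j \<longrightarrow> cinner (e i) (e j) = 0"
    by (elim exE conjE) (rule that, assumption+)
  then have e: "norm (e i) = 1" "A *v e i = d i *\<^sub>R e i"
    "i \<noteq> j \<Longrightarrow> cinner (e i) (e j) = 0" for i j
    by blast+
  define U :: "complex^'n^'n" where "U = (\<chi> i j. e j $ i)"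
  have "(ctranspose U ** U) $ i $ j = cinner (e i) (e j)" for i j
    by (simp add: matrix_matrix_mult_def U_def cinner_def)
  then have UU: "ctranspose U ** U = mat 1"
    using e by (simp add: vec_eq_iff mat_def cinner_self)
  then have U: "unitary_matrix U"
    using matrix_left_right_inverse[of "ctranspose U" U] by (simp add: unitary_matrix_def)
  have "(A ** U) $ i $ j = (A *v e j) $ i" for i j
    by (simp add: matrix_matrix_mult_def matrix_vector_mult_def U_def)
  then have "A ** U = U ** diag_matrix (\<chi> i. d i)"
    by (simp add: vec_eq_iff diag_matrix_mult_right e(2) U_def scaleR_conv_of_real[where 'a=complex] mult.commute)
  then have "A ** (U ** ctranspose U) = U ** diag_matrix (\<chi> i. d i) ** ctranspose U"
    by (simp add: matrix_mul_assoc)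
  then have "A = U ** diag_matrix (\<chi> i. d i) ** ctranspose U"
    using U by (simp add: unitary_matrix_def)
  then show thesis using U that by blast
qed

lemma hermitian_unitary_conj_diag: "hermitian_matrix (U ** diag_matrix d ** ctranspose U)"
  by (simp add: hermitian_matrix_def ctranspose_mult matrix_mul_assoc)

lemma qform_diagonalized:
  "qform (U ** diag_matrix d ** ctranspose U) v = (\<Sum>i\<in>UNIV. d $ i * (cmod ((ctranspose U *v v) $ i))\<^sup>2)"
proof -
  define w where "w = ctranspose U *v v"
  have "(diag_matrix d *v w) $ i = d $ i * w $ i" for i
  proof -
    have "(diag_matrix d *v w) $ i = (\<Sum>j\<in>UNIV. if j = i then d $ i * w $ i else 0)"
      unfolding matrix_vector_mult_def diag_matrix_def vec_lambda_beta by (intro sum.cong) auto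
    then show ?thesis by simp
  qed
  then have "cinner w (diag_matrix d *v w) = complex_of_real (\<Sum>i\<in>UNIV. d $ i * (cmod (w $ i))\<^sup>2)"
    by (simp add: cinner_def complex_norm_square mult.commute mult.left_commute del: of_real_power)
  moreover have "cinner v ((U ** diag_matrix d ** ctranspose U) *v v) = cinner w (diag_matrix d *v w)"
    using cinner_adjoint[of "ctranspose U" v "diag_matrix d *v w"]
    by (simp add: w_def matrix_vector_mul_assoc matrix_mul_assoc)
  ultimately show ?thesis
    by (simp add: qform_def w_def)
qed

theorem psd_diagonalizable:
  assumes "psd_matrix A"
  obtains U d where "unitary_matrix U" "\<And>i. d $ i \<ge> 0" "A = U ** diag_matrix d ** ctranspose U"
proof -
  obtain U d where U: "unitary_matrix U" and A: "A = U ** diag_matrix d ** ctranspose U"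
    using hermitian_diagonalizable assms unfolding psd_matrix_def by blast
  have "d $ i \<ge> 0" for i
  proof -
    have "qform A (U *v axis i 1) \<ge> 0"
      using assms by (simp add: psd_iff_qform)
    also have "ctranspose U *v (U *v axis i 1) = axis i 1"
      using U by (simp add: matrix_vector_mul_assoc unitary_matrix_def)
    then have "qform A (U *v axis i 1) = d $ i"
      by (simp add: A qform_diagonalized axis_def if_distrib[where f=cmod]
         if_distrib[where f="\<lambda>x. x\<^sup>2"] if_distrib[where f="\<lambda>x. _ * x"] cong: if_cong)
    finally show ?thesis .
  qed
  then show thesis using U A that by blast
qed

section \<open>Eigenvalue domination\<close>

text \<open>
  Comparing the numbers of values above every threshold is the same as comparing the two
  families after sorting: match a largest value of \<open>f\<close> with a largest value of \<open>m\<close>,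
  remove both, and recurse.
\<close>

lemma bij_betw_dominating:
  fixes f :: "'a \<Rightarrow> real" and m :: "'b \<Rightarrow> real"
  assumes "finite A" "finite B" "card A = card B"
    and "\<And>\<mu>. card {i \<in> A. \<mu> < f i} \<le> card {j \<in> B. \<mu> < m j}"
  shows "\<exists>\<pi>. bij_betw \<pi> A B \<and> (\<forall>i\<in>A. f i \<le> m (\<pi> i))"
  using assms
proof (induction "card A" arbitrary: A B)
  case 0
  then show ?case by (auto simp: bij_betw_def)
next
  case (Suc n)
  then have ne: "A \<noteq> {}" "B \<noteq> {}" by auto
  have "Max (f ` A) \<in> f ` A" "Max (m ` B) \<in> m ` B"
    using Suc.prems(1,2) ne by (auto intro!: Max_in)
  then obtain i j where i: "i \<in> A" "Max (f ` A) = f i" and j: "j \<in> B" "Max (m ` B) = m j"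
    by (elim imageE) (rule that)
  have imax: "f k \<le> f i" if "k \<in> A" for k
    using Suc.prems(1) that unfolding i(2)[symmetric] by simp
  have jmax: "m k \<le> m j" if "k \<in> B" for k
    using Suc.prems(2) that unfolding j(2)[symmetric] by simp
  have ij: "f i \<le> m j"
  proof (rule ccontr)
    assume "\<not> f i \<le> m j"
    then have "i \<in> {k \<in> A. m j < f k}"
      using i(1) by simp
    then have "card {k \<in> A. m j < f k} > 0"
      using Suc.prems(1) by (auto simp: card_gt_0_iff)
    moreover have "{k \<in> B. m j < m k} = {}"
      using jmax by (auto simp: not_less)
    ultimately show False using Suc.prems(4)[of "m j"] by (metis card.empty not_less)
  qed
  have "card {k \<in> A - {i}. \<mu> < f k} \<le> card {k \<in> B - {j}. \<mu> < m k}" for \<mu>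
  proof (cases "\<mu> < f i")
    case True
    have "{k \<in> A - {i}. \<mu> < f k} = {k \<in> A. \<mu> < f k} - {i}"
      "{k \<in> B - {j}. \<mu> < m k} = {k \<in> B. \<mu> < m k} - {j}" by auto
    then show ?thesis
      using Suc.prems(4)[of \<mu>] True ij i(1) j(1) Suc.prems(1,2) by (simp add: card_Diff_singleton)
  next
    case False
    then have "{k \<in> A - {i}. \<mu> < f k} = {}" using imax False by force
    then have "card {k \<in> A - {i}. \<mu> < f k} = 0" by (metis card.empty)
    then show ?thesis by simp
  qed
  moreover have "n = card (A - {i})" "card (A - {i}) = card (B - {j})"
    using Suc.hyps(2) Suc.prems(1-3) i(1) j(1) by simp_all
  ultimately obtain \<pi> where \<pi>: "bij_betw \<pi> (A - {i}) (B - {j})" "\<forall>k\<in>A - {i}. f k \<le> m (\<pi> k)"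
    using Suc.hyps(1)[of "A - {i}" "B - {j}"] Suc.prems(1,2) by auto
  have "bij_betw (\<pi>(i := j)) A B"
  proof -
    have "bij_betw (\<pi>(i := j)) (A - {i}) (B - {j})"
      using \<pi>(1) by (rule bij_betw_cong[THEN iffD1, rotated]) auto
    then have "bij_betw (\<pi>(i := j)) (A - {i} \<union> {i}) (B - {j} \<union> {(\<pi>(i := j)) i})"
      by (subst notIn_Un_bij_betw3[symmetric]) auto
    moreover have "A - {i} \<union> {i} = A" "B - {j} \<union> {(\<pi>(i := j)) i} = B"
      using i(1) j(1) by auto
    ultimately show ?thesis by simp
  qed
  then show ?case using \<pi>(2) ij by (intro exI[of _ "\<pi>(i := j)"]) auto
qed

text \<open>
  A Courant--Fischer argument. If more eigenvalues of the Hermitian matrix exceed \<open>\<mu>\<close> than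
  there are equations in the hypothesis, some nonzero \<open>w\<close> in the span of the corresponding
  eigenvectors satisfies all of these equations, and there the form is larger than
  \<open>\<mu>\<close> times the squared norm. The matrix \<open>C\<close> in front of \<open>w\<close> gives the freedom to
  restrict \<open>C w\<close> instead of \<open>w\<close> to a spectral subspace; the count of equations does not
  change.
\<close>

lemma eigenvalue_count:
  fixes C :: "complex^'n^'n" and m g :: "real^'n"
  assumes U: "unitary_matrix U"
    and le: "\<And>w. (\<And>i. \<mu> < m $ i \<Longrightarrow> (ctranspose V *v (C *v w)) $ i = 0) \<Longrightarrow>
      qform (U ** diag_matrix g ** ctranspose U) w \<le> \<mu> * (norm w)\<^sup>2"
  shows "card {i. \<mu> < g $ i} \<le> card {i. \<mu> < m $ i}"
proof (rule ccontr)
  assume "\<not> ?thesis"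
  then obtain z where z: "z \<noteq> 0" "\<And>i. \<not> \<mu> < g $ i \<Longrightarrow> z $ i = 0"
    "\<And>j. \<mu> < m $ j \<Longrightarrow> (\<Sum>i\<in>UNIV. (ctranspose V ** C ** U) $ j $ i * z $ i) = 0"
    using homogeneous_system[of "{i. \<mu> < m $ i}" "{i. \<mu> < g $ i}" "\<lambda>j. (ctranspose V ** C ** U) $ j"]
    by auto
  define w where "w = U *v z"
  have Uw: "ctranspose U *v w = z"
    using U by (simp add: w_def matrix_vector_mul_assoc unitary_matrix_def)
  have "ctranspose V *v (C *v w) = (ctranspose V ** C ** U) *v z"
    by (simp add: w_def matrix_vector_mul_assoc matrix_mul_assoc)
  then have "qform (U ** diag_matrix g ** ctranspose U) w \<le> \<mu> * (norm w)\<^sup>2"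
    using z(3) by (intro le) (simp add: matrix_vector_mult_def)
  also have "(norm w)\<^sup>2 = (\<Sum>i\<in>UNIV. (cmod (z $ i))\<^sup>2)"
    using unitary_norm[OF U] by (simp add: w_def norm_power2_sum)
  finally have "(\<Sum>i\<in>UNIV. g $ i * (cmod (z $ i))\<^sup>2) \<le> (\<Sum>i\<in>UNIV. \<mu> * (cmod (z $ i))\<^sup>2)"
    by (simp add: qform_diagonalized Uw sum_distrib_left)
  moreover obtain k where "z $ k \<noteq> 0"
    using z(1) by (auto simp: vec_eq_iff)
  then have "(\<Sum>i\<in>UNIV. \<mu> * (cmod (z $ i))\<^sup>2) < (\<Sum>i\<in>UNIV. g $ i * (cmod (z $ i))\<^sup>2)"
  proof (intro sum_strict_mono_ex1 ballI bexI[of _ k])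
    fix i
    show "\<mu> * (cmod (z $ i))\<^sup>2 \<le> g $ i * (cmod (z $ i))\<^sup>2"
      using z(2)[of i] by (cases "\<mu> < g $ i") (auto intro!: mult_right_mono)
    show "\<mu> * (cmod (z $ k))\<^sup>2 < g $ k * (cmod (z $ k))\<^sup>2"
      using z(2)[of k] \<open>z $ k \<noteq> 0\<close> by auto
  qed simp_all
  ultimately show False by simp
qed

text \<open>
  Because \<open>m \<ge> 0\<close>, positive thresholds suffice: nothing is to be compared below zero, and the
  threshold zero is reached from above since there are only finitely many eigenvalues.
\<close>

lemma eigenvalues_dominated:
  fixes C :: "complex^'n^'n" and m g :: "real^'n"
  assumes U: "unitary_matrix U" and m: "\<And>i. 0 \<le> m $ i"
    and le: "\<And>\<mu> w. 0 < \<mu> \<Longrightarrow> (\<And>i. \<mu> < m $ i \<Longrightarrow> (ctranspose V *v (C *v w)) $ i = 0) \<Longrightarrow>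
      qform (U ** diag_matrix g ** ctranspose U) w \<le> \<mu> * (norm w)\<^sup>2"
  obtains \<pi> where "bij \<pi>" "\<And>i. g $ i \<le> m $ \<pi> i"
proof -
  have pos: "card {i. \<mu> < g $ i} \<le> card {i. \<mu> < m $ i}" if "0 < \<mu>" for \<mu>
    using eigenvalue_count[OF U, of \<mu> m V C g] le[OF that] by blast
  have "card {i. \<mu> < g $ i} \<le> card {i. \<mu> < m $ i}" for \<mu>
  proof (cases \<mu> "0::real" rule: linorder_cases)
    case less
    then have "{i. \<mu> < m $ i} = UNIV" using m by (auto intro: less_le_trans)
    then show ?thesis using card_mono[of UNIV "{i. \<mu> < g $ i}"] by simp
  next
    case equal
    define \<epsilon> where "\<epsilon> = Min (insert 1 ((\<lambda>i. g $ i) ` {i. 0 < g $ i})) / 2"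
    have pos_Min: "0 < Min (insert 1 ((\<lambda>i. g $ i) ` {i. 0 < g $ i}))"
      by (subst Min_gr_iff) auto
    have \<epsilon>: "0 < \<epsilon>" using pos_Min by (simp add: \<epsilon>_def)
    have "\<epsilon> < g $ i" if "0 < g $ i" for i
    proof -
      have "Min (insert 1 ((\<lambda>i. g $ i) ` {i. 0 < g $ i})) \<le> g $ i"
        using that by (intro Min_le) auto
      then show ?thesis using pos_Min that unfolding \<epsilon>_def by linarith
    qed
    then have "card {i. \<mu> < g $ i} \<le> card {i. \<epsilon> < g $ i}"
      by (intro card_mono) (auto simp: equal)
    also have "\<dots> \<le> card {i. \<epsilon> < m $ i}"
      by (rule pos[OF \<epsilon>])
    also have "\<dots> \<le> card {i. \<mu> < m $ i}"
      using \<epsilon> by (intro card_mono) (auto simp: equal intro: less_trans)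
    finally show ?thesis .
  qed (rule pos)
  then obtain \<pi> where "bij_betw \<pi> (UNIV::'n set) (UNIV::'n set)" "\<forall>i\<in>UNIV. g $ i \<le> m $ \<pi> i"
    using bij_betw_dominating[of "UNIV::'n set" "UNIV::'n set" "\<lambda>i. g $ i" "\<lambda>i. m $ i"] by auto
  then show thesis using that by auto
qed

definition permutation_matrix :: "('n \<Rightarrow> 'n) \<Rightarrow> complex^'n^'n" where
  "permutation_matrix \<pi> = (\<chi> i j. if j = \<pi> i then 1 else 0)"

lemma permutation_matrix_conj_diag:
  assumes "bij \<pi>"
  shows "permutation_matrix \<pi> ** diag_matrix d ** ctranspose (permutation_matrix \<pi>) =
    diag_matrix (\<chi> i. d $ \<pi> i)"
proof -
  have "(permutation_matrix \<pi> ** (diag_matrix d ** ctranspose (permutation_matrix \<pi>))) $ i $ j =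
      (if i = j then d $ \<pi> i else 0)" for i j
  proof -
    have "(permutation_matrix \<pi> ** (diag_matrix d ** ctranspose (permutation_matrix \<pi>))) $ i $ j =
        (\<Sum>k\<in>UNIV. (if k = \<pi> i then complex_of_real (d $ k) * (if k = \<pi> j then 1 else 0) else 0))"
      unfolding matrix_matrix_mult_def[of "permutation_matrix \<pi>"] vec_lambda_beta
        diag_matrix_mult_left ctranspose_nth
      by (intro sum.cong) (auto simp: permutation_matrix_def)
    then show ?thesis using assms by (auto simp: inj_eq bij_is_inj)
  qed
  then show ?thesis by (simp add: vec_eq_iff diag_matrix_def matrix_mul_assoc)
qed

lemma unitary_permutation_matrix:
  fixes \<pi> :: "'n::finite \<Rightarrow> 'n"
  assumes "bij \<pi>"
  shows "unitary_matrix (permutation_matrix \<pi>)"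
proof -
  have "diag_matrix (\<chi> i. 1) = (mat 1 :: complex^'n^'n)"
    by (simp add: vec_eq_iff diag_matrix_def mat_def)
  then have "permutation_matrix \<pi> ** ctranspose (permutation_matrix \<pi>) = mat 1"
    using permutation_matrix_conj_diag[OF assms, of "\<chi> i. 1"] by simp
  then show ?thesis
    using matrix_left_right_inverse unfolding unitary_matrix_def by blast
qed

section \<open>Monotonicity of unitarily invariant norms\<close>

lemma unitarily_invariant_norm_simps:
  assumes "unitarily_invariant_norm N"
  shows unitarily_invariant_norm_left: "unitary_matrix U \<Longrightarrow> N (U ** A) = N A"
    and unitarily_invariant_norm_right: "unitary_matrix U \<Longrightarrow> N (A ** U) = N A"
    and unitarily_invariant_norm_triangle: "N (A + B) \<le> N A + N B"
    and unitarily_invariant_norm_scaleR: "N (r *\<^sub>R A) = \<bar>r\<bar> * N A"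
proof -
  have inv: "unitary_matrix U \<Longrightarrow> unitary_matrix V \<Longrightarrow> N (U ** A ** V) = N A" for U V A
    using assms by (simp add: unitarily_invariant_norm_def)
  show "unitary_matrix U \<Longrightarrow> N (U ** A) = N A"
    using inv[OF _ unitary_mat_1, of U A] by simp
  show "unitary_matrix U \<Longrightarrow> N (A ** U) = N A"
    using inv[OF unitary_mat_1, of U A] by simp
  show "N (A + B) \<le> N A + N B"
    using assms by (simp add: unitarily_invariant_norm_def matrix_norm_def)
  have "r *\<^sub>R A = map_matrix ((*) (complex_of_real r)) A"
    by (simp add: vec_eq_iff map_matrix_def) (simp add: scaleR_conv_of_real)
  then show "N (r *\<^sub>R A) = \<bar>r\<bar> * N A"
    using assms by (simp add: unitarily_invariant_norm_def matrix_norm_def)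
qed

text \<open>
  Shrinking one diagonal entry means averaging the matrix with its image under the unitary
  matrix that flips the sign of this entry, with weights \<open>(1 + \<theta>) / 2\<close> and \<open>(1 - \<theta>) / 2\<close>.
\<close>

lemma unitarily_invariant_norm_diag_shrink:
  assumes N: "unitarily_invariant_norm N" and r: "0 \<le> r" "r \<le> q $ k"
  shows "N (diag_matrix (\<chi> i. if i = k then r else q $ i)) \<le> N (diag_matrix q)"
proof (cases "q $ k = 0")
  case True
  then have "(\<chi> i. if i = k then r else q $ i) = q"
    using r by (auto simp: vec_eq_iff)
  then show ?thesis by simp
next
  case False
  define \<theta> where "\<theta> = r / q $ k"
  have \<theta>: "0 \<le> \<theta>" "\<theta> \<le> 1" "r = \<theta> * q $ k"
    using r False by (auto simp: \<theta>_def)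
  define R where "R = diag_matrix (\<chi> i. if i = k then - 1 else 1)"
  have "R ** R = mat 1"
    unfolding R_def by (simp add: vec_eq_iff diag_matrix_mult_left) (simp add: diag_matrix_def mat_def)
  then have R: "unitary_matrix R"
    by (simp add: unitary_matrix_def) (simp add: R_def)
  have "diag_matrix (\<chi> i. if i = k then r else q $ i) =
      ((1 + \<theta>) / 2) *\<^sub>R diag_matrix q + ((1 - \<theta>) / 2) *\<^sub>R (R ** diag_matrix q)"
    unfolding R_def
    by (simp add: vec_eq_iff diag_matrix_mult_left)
      (auto simp: diag_matrix_def \<theta>(3) scaleR_conv_of_real field_simps)
  also have "N \<dots> \<le> (1 + \<theta>) / 2 * N (diag_matrix q) + (1 - \<theta>) / 2 * N (diag_matrix q)"
    by (rule order_trans[OF unitarily_invariant_norm_triangle[OF N]])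
      (use \<theta> in \<open>simp add: unitarily_invariant_norm_scaleR[OF N] unitarily_invariant_norm_left[OF N R]\<close>)
  also have "\<dots> = N (diag_matrix q)"
    by (simp add: field_simps)
  finally show ?thesis .
qed

lemma unitarily_invariant_norm_diag_mono:
  fixes p q :: "real^'n"
  assumes N: "unitarily_invariant_norm N" and pq: "\<And>i. 0 \<le> p $ i" "\<And>i. p $ i \<le> q $ i"
  shows "N (diag_matrix p) \<le> N (diag_matrix q)"
proof -
  have "N (diag_matrix (\<chi> i. if i \<in> I then p $ i else q $ i)) \<le> N (diag_matrix q)" for I :: "'n set"
  proof (induction I rule: finite_induct[OF finite])
    case 1
    then show ?case by simp
  next
    case (2 k I)
    let ?q = "\<chi> i. if i \<in> I then p $ i else q $ i"
    have "N (diag_matrix (\<chi> i. if i = k then p $ k else ?q $ i)) \<le> N (diag_matrix ?q)"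
      using pq 2(2) by (intro unitarily_invariant_norm_diag_shrink[OF N]) auto
    moreover have "(\<chi> i. if i = k then p $ k else ?q $ i) = (\<chi> i. if i \<in> insert k I then p $ i else q $ i)"
      by (auto simp: vec_eq_iff)
    ultimately show ?case using 2(3) by simp
  qed
  from this[of UNIV] show ?thesis by simp
qed

lemma unitarily_invariant_norm_conj:
  assumes "unitarily_invariant_norm N" "unitary_matrix U"
  shows "N (U ** A ** ctranspose U) = N A"
  using assms by (simp add: unitarily_invariant_norm_left unitarily_invariant_norm_right unitary_adjoint)

text \<open>
  A unitarily invariant norm of a positive semidefinite matrix depends only on the multiset
  of its eigenvalues and increases with each of them; the eigenvalues increase with the
  quadratic form.
\<close>

theorem unitarily_invariant_norm_psd_mono:
  fixes X Z :: "complex^'n^'n"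
  assumes N: "unitarily_invariant_norm N" and X: "psd_matrix X" and Z: "psd_matrix Z"
    and le: "\<And>v. qform X v \<le> qform Z v"
  shows "N X \<le> N Z"
proof -
  obtain U p where U: "unitary_matrix U" and p: "\<And>i. 0 \<le> p $ i"
    and X_eq: "X = U ** diag_matrix p ** ctranspose U"
    using psd_diagonalizable[OF X] by blast
  obtain V q where V: "unitary_matrix V" and q: "\<And>i. 0 \<le> q $ i"
    and Z_eq: "Z = V ** diag_matrix q ** ctranspose V"
    using psd_diagonalizable[OF Z] by blast
  obtain \<pi> where \<pi>: "bij \<pi>" "\<And>i. p $ i \<le> q $ \<pi> i"
  proof (rule eigenvalues_dominated[OF U q, where g=p and C="mat 1" and V=V])
    fix \<mu> :: real and w
    assume "0 < \<mu>" and w: "\<And>i. \<mu> < q $ i \<Longrightarrow> (ctranspose V *v (mat 1 *v w)) $ i = 0"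
    have "qform Z w = (\<Sum>i\<in>UNIV. q $ i * (cmod ((ctranspose V *v w) $ i))\<^sup>2)"
      by (simp add: Z_eq qform_diagonalized)
    also have "\<dots> \<le> (\<Sum>i\<in>UNIV. \<mu> * (cmod ((ctranspose V *v w) $ i))\<^sup>2)"
    proof (rule sum_mono)
      fix i
      show "q $ i * (cmod ((ctranspose V *v w) $ i))\<^sup>2 \<le> \<mu> * (cmod ((ctranspose V *v w) $ i))\<^sup>2"
        using w[of i] by (cases "\<mu> < q $ i") (auto intro: mult_right_mono)
    qed
    also have "\<dots> = \<mu> * (norm w)\<^sup>2"
      using unitary_norm[OF unitary_adjoint[OF V], of w]
      by (simp add: norm_power2_sum[symmetric] sum_distrib_left[symmetric])
    finally show "qform (U ** diag_matrix p ** ctranspose U) w \<le> \<mu> * (norm w)\<^sup>2"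
      using le[of w] X_eq by simp
  qed (use that in blast)
  have "N X = N (diag_matrix p)"
    by (simp add: X_eq unitarily_invariant_norm_conj[OF N U])
  also have "\<dots> \<le> N (diag_matrix (\<chi> i. q $ \<pi> i))"
    using p \<pi>(2) by (intro unitarily_invariant_norm_diag_mono[OF N]) auto
  also have "\<dots> = N (diag_matrix q)"
    using unitarily_invariant_norm_conj[OF N unitary_permutation_matrix[OF \<pi>(1)], of "diag_matrix q"]
    by (simp add: permutation_matrix_conj_diag[OF \<pi>(1)])
  also have "\<dots> = N Z"
    by (simp add: Z_eq unitarily_invariant_norm_conj[OF N V])
  finally show ?thesis .
qed

section \<open>Polar decomposition\<close>

text \<open>
  Over the complex numbers a matrix is determined by its quadratic form (polarization), and the
  form of \<open>X - X*\<close> vanishes because that of \<open>X\<close> is real.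
\<close>

lemma hermitian_of_cinner_nonneg:
  fixes X :: "complex^'n^'n"
  assumes pos: "\<And>v. cinner v (X *v v) \<in> \<real>\<^sub>\<ge>\<^sub>0"
  shows "hermitian_matrix X"
proof -
  define D where "D = X - ctranspose X"
  have zero: "cinner v (D *v v) = 0" for v
  proof -
    have "cinner v (ctranspose X *v v) = cnj (cinner v (X *v v))"
      using cinner_adjoint[of X v v] cinner_commute[of "X *v v" v] by simp
    moreover have "cnj (cinner v (X *v v)) = cinner v (X *v v)"
      using pos[of v] by (metis Reals_cnj_iff nonneg_Reals_subset_Reals subsetD)
    ultimately show ?thesis
      by (simp add: D_def matrix_vector_mult_diff_rdistrib cinner_diff_right)
  qed
  have skew: "cinner u (D *v v) + cinner v (D *v u) = 0" for u v
    using zero[of "u + v"] by (simp add: matrix_vector_right_distrib cinner_add_left cinner_add_right zero add.commute)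
  have "cinner u (D *v v) = 0" for u v
  proof -
    have "\<i> * cinner u (D *v v) - \<i> * cinner v (D *v u) = 0"
      using skew[of u "\<i> *s v"]
      by (simp add: vector_scalar_commute cinner_scale_left cinner_scale_right)
    then show ?thesis using skew[of u v] by (auto simp: complex_eq_iff)
  qed
  from this[of "axis i 1" "axis j 1" for i j] have "D $ i $ j = 0" for i j
    by (simp add: cinner_def matrix_vector_mult_def axis_def if_distrib[where f=cnj]
        if_distrib[where f="\<lambda>x. x * _"] if_distrib[where f="\<lambda>x. _ * x"] cong: if_cong)
  then have "X $ i $ j = ctranspose X $ i $ j" for i j
    unfolding D_def vector_minus_component right_minus_eq .
  then have "ctranspose X $ i $ j = X $ i $ j" for i j
    by (rule sym)
  then show ?thesis
    unfolding hermitian_matrix_def vec_eq_iff by (intro allI)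
qed

lemma compact_unitary: "compact {W :: complex^'n^'n. unitary_matrix W}"
proof -
  have "norm W \<le> CARD('n)" if "unitary_matrix W" for W :: "complex^'n^'n"
  proof -
    have "norm (W $ i) = 1" for i
    proof -
      have "complex_of_real ((norm (W $ i))\<^sup>2) = (W ** ctranspose W) $ i $ i"
        unfolding cinner_self[symmetric] by (simp add: matrix_matrix_mult_def cinner_def mult.commute)
      then have "complex_of_real ((norm (W $ i))\<^sup>2) = complex_of_real 1"
        using that by (simp add: unitary_matrix_def mat_def)
      then have "(norm (W $ i))\<^sup>2 = 1"
        unfolding of_real_eq_iff .
      then show ?thesis using norm_ge_zero[of "W $ i"] by (auto simp: power2_eq_1_iff)
    qed
    then show ?thesis
      using L2_set_le_sum[of UNIV "\<lambda>i. norm (W $ i)"] by (simp add: norm_vec_def[of W])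
  qed
  then have "bounded {W :: complex^'n^'n. unitary_matrix W}"
    by (auto simp: bounded_iff)
  moreover have "closed {W :: complex^'n^'n. unitary_matrix W}"
    unfolding unitary_matrix_def matrix_matrix_mult_def ctranspose_nth
    by (intro closed_Collect_conj closed_Collect_eq continuous_intros continuous_on_vec_lambda)
  ultimately show ?thesis by (simp add: compact_eq_bounded_closed)
qed

text \<open>
  The matrix that multiplies the unit vector \<open>w\<close> by the phase \<open>e\<close> and fixes its orthogonal
  complement. These are the competitors that force the positivity of the second polar factor.
\<close>

lemma unitary_phase_reflection:
  fixes w :: "complex^'n"
  assumes w: "norm w = 1" and e: "cmod e = 1"
  shows "unitary_matrix (\<chi> i j. (if i = j then 1 else 0) + (e - 1) * (w $ i * cnj (w $ j)))"
    (is "unitary_matrix ?R")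
proof -
  have e1: "cnj e * e = 1"
    using e by (metis complex_norm_square mult.commute of_real_1 one_power2)
  have w1: "(\<Sum>k\<in>UNIV. cnj (w $ k) * w $ k) = 1"
    using cinner_self[of w] w by (simp add: cinner_def)
  have "(ctranspose ?R ** ?R) $ i $ j = (if i = j then 1 else 0)" for i j
  proof -
    have "(ctranspose ?R ** ?R) $ i $ j = (\<Sum>k\<in>UNIV.
        (if k = i then (if i = j then 1 else 0) + (e - 1) * (w $ i * cnj (w $ j)) else 0) +
        (if k = j then (cnj e - 1) * (w $ i * cnj (w $ j)) else 0) +
        (cnj e - 1) * (e - 1) * (w $ i * cnj (w $ j)) * (cnj (w $ k) * w $ k))"
      unfolding matrix_matrix_mult_def vec_lambda_beta ctranspose_nth
      by (intro sum.cong) (auto simp: algebra_simps)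
    also have "\<dots> = (if i = j then 1 else 0) + (e - 1) * (w $ i * cnj (w $ j)) +
        (cnj e - 1) * (w $ i * cnj (w $ j)) + (cnj e - 1) * (e - 1) * (w $ i * cnj (w $ j))"
      by (simp add: sum.distrib sum_distrib_left[symmetric] w1)
    also have "\<dots> = (if i = j then 1 else 0) + (cnj e * e - 1) * (w $ i * cnj (w $ j))"
      by (simp add: algebra_simps)
    finally show ?thesis by (simp add: e1)
  qed
  then have "ctranspose ?R ** ?R = mat 1"
    by (simp add: vec_eq_iff mat_def)
  then show ?thesis
    using matrix_left_right_inverse unfolding unitary_matrix_def by blast
qed

text \<open>
  Choose a unitary \<open>W\<close> maximizing \<open>Re (trace (W* T))\<close>, which exists by compactness. If
  \<open>z = \<langle>w, W* T w\<rangle>\<close> were not a nonnegative real number, rotating the direction \<open>w\<close> by the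
  phase of \<open>z\<close> would replace \<open>Re z\<close> by \<open>\<bar>z\<bar>\<close> in the trace. This argument produces
  a unitary factor for singular \<open>T\<close> as well.
\<close>

theorem polar_decomposition:
  fixes T :: "complex^'n^'n"
  obtains W X where "unitary_matrix W" "psd_matrix X" "T = W ** X"
proof -
  have "continuous_on {W :: complex^'n^'n. unitary_matrix W} (\<lambda>W. Re (trace (ctranspose W ** T)))"
    unfolding trace_def matrix_matrix_mult_def vec_lambda_beta ctranspose_nth
    by (intro continuous_intros)
  then obtain W where W: "unitary_matrix W"
    and max: "\<And>V. unitary_matrix V \<Longrightarrow> Re (trace (ctranspose V ** T)) \<le> Re (trace (ctranspose W ** T))"
    using continuous_attains_sup[OF compact_unitary] unitary_mat_1 by blast
  define X where "X = ctranspose W ** T"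
  have unit: "cinner w (X *v w) \<in> \<real>\<^sub>\<ge>\<^sub>0" if w: "norm w = 1" for w
  proof (cases "cinner w (X *v w) = 0")
    case False
    define z where "z = cinner w (X *v w)"
    define e where "e = z / cmod z"
    have e: "cmod e = 1" using False by (simp add: e_def z_def norm_divide)
    define R where "R = (\<chi> i j. (if i = j then 1 else 0) + (e - 1) * (w $ i * cnj (w $ j)))"
    have R: "unitary_matrix R"
      unfolding R_def by (rule unitary_phase_reflection[OF w e])
    have "trace (ctranspose (W ** R) ** T) = trace (ctranspose R ** X)"
      by (simp add: ctranspose_mult X_def matrix_mul_assoc)
    also have "\<dots> = (\<Sum>i\<in>UNIV. \<Sum>k\<in>UNIV. (if k = i then X $ i $ i else 0) +
        (cnj e - 1) * (cnj (w $ k) * (X $ k $ i * w $ i)))"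
      unfolding trace_def matrix_matrix_mult_def vec_lambda_beta ctranspose_nth R_def
      by (intro sum.cong refl) (auto simp: algebra_simps)
    also have "\<dots> = trace X + (\<Sum>i\<in>UNIV. \<Sum>k\<in>UNIV. (cnj e - 1) * (cnj (w $ k) * (X $ k $ i * w $ i)))"
      by (simp add: sum.distrib trace_def)
    also have "(\<Sum>i\<in>UNIV. \<Sum>k\<in>UNIV. (cnj e - 1) * (cnj (w $ k) * (X $ k $ i * w $ i))) =
        (\<Sum>k\<in>UNIV. \<Sum>i\<in>UNIV. (cnj e - 1) * (cnj (w $ k) * (X $ k $ i * w $ i)))"
      by (rule sum.swap)
    also have "\<dots> = (cnj e - 1) * z"
      by (simp add: z_def cinner_def matrix_vector_mult_def sum_distrib_left)
    finally have "Re ((cnj e - 1) * z) \<le> 0"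
      using max[OF unitary_mult[OF W R]] by (simp add: X_def)
    moreover have "cnj e * z = cmod z"
      using False by (simp add: e_def z_def complex_norm_square[symmetric] field_simps power2_eq_square)
    ultimately have "cmod z \<le> Re z"
      by (simp add: left_diff_distrib)
    then have "0 \<le> Re z" "(cmod z)\<^sup>2 \<le> (Re z)\<^sup>2"
      using norm_ge_zero[of z] by (linarith, intro power_mono) auto
    then have "z \<in> \<real>\<^sub>\<ge>\<^sub>0"
      by (simp add: cmod_power2 complex_nonneg_Reals_iff)
    then show ?thesis by (simp add: z_def)
  qed auto
  have pos: "cinner v (X *v v) \<in> \<real>\<^sub>\<ge>\<^sub>0" for v
  proof (cases "v = 0")
    case False
    have "v = norm v *\<^sub>R ((1 / norm v) *\<^sub>R v)"
      using False by simp
    then have "cinner v (X *v v) = complex_of_real ((norm v)\<^sup>2) *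
        cinner ((1 / norm v) *\<^sub>R v) (X *v ((1 / norm v) *\<^sub>R v))"
      by (metis (no_types, lifting) cinner_scaleR_left cinner_scaleR_right matrix_vector_scaleR
          mult.assoc of_real_mult power2_eq_square)
    also have "\<dots> \<in> \<real>\<^sub>\<ge>\<^sub>0"
      using False by (intro nonneg_Reals_mult_I unit) (auto simp del: of_real_power)
    finally show ?thesis .
  qed (simp add: cinner_def)
  have "psd_matrix X"
    using hermitian_of_cinner_nonneg[OF pos] pos by (simp add: psd_matrix_def cinner_def)
  moreover have "T = W ** X"
    using W by (simp add: X_def matrix_mul_assoc unitary_matrix_def)
  ultimately show thesis using W that by blast
qed

section \<open>Powers of positive semidefinite matrices\<close>

lemma matrix_powr_diagonalized:
  assumes "unitary_matrix U" "t \<noteq> 0"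
  shows "matrix_powr (U ** diag_matrix d ** ctranspose U) t =
    U ** diag_matrix (\<chi> i. d $ i powr t) ** ctranspose U"
  using assms by (simp add: matrix_powr_def matrix_fun_diag)

lemma hermitian_matrix_powr:
  assumes "psd_matrix A" "t \<noteq> 0"
  shows "ctranspose (matrix_powr A t) = matrix_powr A t"
proof -
  obtain U d where "unitary_matrix U" "A = U ** diag_matrix d ** ctranspose U"
    using psd_diagonalizable[OF assms(1)] by blast
  then show ?thesis
    using hermitian_unitary_conj_diag assms(2)
    by (simp add: matrix_powr_diagonalized hermitian_matrix_def)
qed

lemma matrix_powr_add:
  assumes "psd_matrix A" "0 < s" "0 < t"
  shows "matrix_powr A s ** matrix_powr A t = matrix_powr A (s + t)"
proof -
  obtain U d where U: "unitary_matrix U" and A: "A = U ** diag_matrix d ** ctranspose U"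
    using psd_diagonalizable[OF assms(1)] by blast
  have "diag_matrix (\<chi> i. d $ i powr s) ** diag_matrix (\<chi> i. d $ i powr t) =
      diag_matrix (\<chi> i. d $ i powr (s + t))"
    by (simp add: vec_eq_iff diag_matrix_mult_left) (simp add: diag_matrix_def powr_add)
  moreover have "(U ** D ** ctranspose U) ** (U ** E ** ctranspose U) = U ** (D ** E) ** ctranspose U" for D E
  proof -
    have "(U ** D ** ctranspose U) ** (U ** E ** ctranspose U) = U ** D ** (ctranspose U ** U) ** E ** ctranspose U"
      by (simp only: matrix_mul_assoc)
    also have "\<dots> = U ** D ** mat 1 ** E ** ctranspose U"
      using U by (simp only: unitary_matrix_def)
    finally show ?thesis by (simp add: matrix_mul_assoc)
  qed
  ultimately show ?thesis
    using assms(2,3) U by (simp add: A matrix_powr_diagonalized)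
qed

lemma matrix_powr_1:
  assumes "psd_matrix A"
  shows "matrix_powr A 1 = A"
proof -
  obtain U d where U: "unitary_matrix U" "\<And>i. 0 \<le> d $ i" and A: "A = U ** diag_matrix d ** ctranspose U"
    using psd_diagonalizable[OF assms] by blast
  have "(\<chi> i. d $ i powr 1) = d" using U(2) by (simp add: vec_eq_iff)
  then show ?thesis using U(1) by (simp add: A matrix_powr_diagonalized)
qed

lemma matrix_powr_0:
  assumes "psd_matrix A"
  shows "matrix_powr A 0 = mat 1"
proof -
  obtain U d where U: "unitary_matrix U" and A: "A = U ** diag_matrix d ** ctranspose U"
    using psd_diagonalizable[OF assms] by blast
  have "diag_matrix (\<chi> i. 1) = (mat 1 :: complex^'a^'a)"
    by (simp add: vec_eq_iff diag_matrix_def mat_def)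
  then show ?thesis using U by (simp add: A matrix_powr_def matrix_fun_diag unitary_matrix_def)
qed

section \<open>Scalar inequalities\<close>

lemma one_plus_le_powr:
  fixes z p :: real
  assumes "0 \<le> z" "1 \<le> p"
  shows "1 + p * (z - 1) \<le> z powr p"
proof (cases "p = 1")
  case True
  then show ?thesis using assms by simp
next
  case False
  then have p: "1 < p" using assms(2) by simp
  have "z * 1 \<le> z powr p / p + 1 powr (p / (p - 1)) / (p / (p - 1))"
    by (rule Youngs_inequality) (use p assms(1) in \<open>auto simp: divide_simps\<close>)
  then have "z \<le> (z powr p + (p - 1)) / p"
    by (simp add: add_divide_distrib)
  then have "p * z \<le> z powr p + (p - 1)"
    using p by (simp add: pos_le_divide_eq mult.commute)
  then show ?thesis by (simp add: algebra_simps)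
qed

lemma powr_le_tangent:
  fixes b \<mu> q :: real
  assumes "0 \<le> b" "0 < \<mu>" "0 < q" "q \<le> 1"
  shows "b powr q \<le> \<mu> powr (q - 1) * ((1 - q) * \<mu> + q * b)"
proof -
  have "b powr q * \<mu> powr (1 - q) \<le> q * b + (1 - q) * \<mu>"
    using assms by (cases "b = 0") (auto intro!: Youngs_inequality_0)
  then have "\<mu> powr (q - 1) * (b powr q * \<mu> powr (1 - q)) \<le> \<mu> powr (q - 1) * (q * b + (1 - q) * \<mu>)"
    by (rule mult_left_mono) simp
  moreover have "\<mu> powr (q - 1) * (b powr q * \<mu> powr (1 - q)) = b powr q"
    using assms(2) by (simp add: powr_add[symmetric] mult.left_commute)
  ultimately show ?thesis
    by (simp add: add.commute)
qed

text \<open>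
  This is the inequality that remains for each eigenvalue \<open>a\<close> of \<open>x\<close> at the threshold
  \<open>\<mu>\<close>; equality holds at \<open>a = \<mu>\<close>. Put \<open>\<alpha> = a / \<mu>\<close>, \<open>s = 2 t\<close> and \<open>u = \<alpha> powr s\<close>, and
  replace \<open>(1 - r)\<^sup>2\<close> by the larger \<open>(1 - u)\<^sup>2\<close>. Apart from \<open>u\<close>, the variable \<open>\<alpha>\<close> then
  occurs only in a product \<open>\<alpha> b\<close>. Where \<open>b \<le> 0\<close>, the number \<open>\<alpha> = u powr (1 / s)\<close> is bounded
  below by its tangent at \<open>u = 1\<close>; where \<open>b > 0\<close>, one has \<open>u < 1\<close> and \<open>\<alpha> \<le> u\<close>. Both
  substitutions leave a polynomial in \<open>u\<close> that factors.
\<close>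

lemma corrected_half_scalar_inequality:
  fixes a \<mu> t :: real
  assumes a: "0 \<le> a" and \<mu>: "0 < \<mu>" and t: "0 < t" "t \<le> 1/4"
  defines "r \<equiv> (a / \<mu>) powr t" and "\<kappa> \<equiv> 1 - 4 * t"
  shows "2 * t * \<mu> * r\<^sup>2 - (1 - 2 * t) * (a * r\<^sup>2) + \<kappa> * a
    + \<mu> * ((1 + \<kappa>) * r\<^sup>2 - \<kappa> + \<kappa> * (1 + \<kappa>) * (1 - r)\<^sup>2) \<le> \<mu>"
proof -
  define s where "s = 2 * t"
  have s: "0 < s" "s \<le> 1/2" using t by (auto simp: s_def)
  define \<alpha> where "\<alpha> = a / \<mu>"
  have \<alpha>: "0 \<le> \<alpha>" "a = \<mu> * \<alpha>" using a \<mu> by (auto simp: \<alpha>_def)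
  define u where "u = r\<^sup>2"
  have r: "0 \<le> r" by (simp add: r_def)
  have u: "0 \<le> u" "u powr (1 / s) = \<alpha>"
  proof -
    have "u = \<alpha> powr s"
      by (simp add: u_def r_def \<alpha>_def[symmetric] power2_eq_square powr_add[symmetric] s_def)
    then show "u powr (1 / s) = \<alpha>" using s \<alpha> by (simp add: powr_powr)
  qed (simp add: u_def)
  have "(1 - r)\<^sup>2 * 1 \<le> (1 - r)\<^sup>2 * (1 + r)\<^sup>2"
    using r by (intro mult_left_mono) (auto simp: one_le_power)
  then have r_le: "(1 - r)\<^sup>2 \<le> (1 - u)\<^sup>2"
    by (simp add: u_def power_mult_distrib[symmetric] power2_eq_square algebra_simps)
  define b where "b = (1 - 2 * s) - (1 - s) * u"
  have main: "\<alpha> * b + (2 - s) * u - 2 * (1 - s) + 2 * (1 - s) * (1 - 2 * s) * (1 - u)\<^sup>2 \<le> 0"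
  proof (cases "b \<le> 0")
    case True
    have "1 + (u - 1) / s \<le> \<alpha>"
      using one_plus_le_powr[of u "1 / s"] u s by simp
    then have "\<alpha> * b \<le> (1 + (u - 1) / s) * b"
      using True by (intro mult_right_mono_neg)
    moreover have "(1 + (u - 1) / s) * b + (2 - s) * u - 2 * (1 - s) + 2 * (1 - s) * (1 - 2 * s) * (1 - u)\<^sup>2
        = (1 - s) * (1 - u)\<^sup>2 * (2 * (1 - 2 * s) - 1 / s)"
      using s by (simp add: b_def field_simps power2_eq_square)
    moreover have "2 * (1 - 2 * s) - 1 / s \<le> 0"
    proof -
      have "2 * (1 - 2 * s) \<le> 2" using s by simp
      also have "2 \<le> 1 / s" using s by (simp add: field_simps)
      finally show ?thesis by (simp only: diff_le_0_iff_le)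
    qed
    then have "(1 - s) * (1 - u)\<^sup>2 * (2 * (1 - 2 * s) - 1 / s) \<le> 0"
      using s by (intro mult_nonneg_nonpos) auto
    ultimately show ?thesis by linarith
  next
    case False
    moreover have "b = (1 - s) * (1 - u) - s"
      by (simp add: b_def algebra_simps)
    ultimately have "0 < (1 - s) * (1 - u)" using s by linarith
    then have u1: "u < 1" using s by (simp add: zero_less_mult_iff)
    have "\<alpha> \<le> u"
    proof -
      have "u powr (1 / s) \<le> u powr 1"
        using u u1 s by (intro powr_mono') auto
      then show ?thesis using u by simp
    qed
    then have "\<alpha> * b \<le> u * b"
      using False by (intro mult_right_mono) auto
    moreover have "u * b + (2 - s) * u - 2 * (1 - s) + 2 * (1 - s) * (1 - 2 * s) * (1 - u)\<^sup>2
        = - ((1 - u) * (1 - s) * (u + 4 * s * (1 - u)))"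
      by (simp add: b_def algebra_simps power2_eq_square)
    moreover have "0 \<le> (1 - u) * (1 - s) * (u + 4 * s * (1 - u))"
      using u u1 s by (intro mult_nonneg_nonneg add_nonneg_nonneg) auto
    ultimately show ?thesis by linarith
  qed
  have "2 * (1 - s) * (1 - 2 * s) * (1 - r)\<^sup>2 \<le> 2 * (1 - s) * (1 - 2 * s) * (1 - u)\<^sup>2"
    using s r_le by (intro mult_left_mono) auto
  with main have "\<alpha> * b + (2 - s) * u - 2 * (1 - s) + 2 * (1 - s) * (1 - 2 * s) * (1 - r)\<^sup>2 \<le> 0"
    by linarith
  then have "\<mu> * (\<alpha> * b + (2 - s) * u - 2 * (1 - s) + 2 * (1 - s) * (1 - 2 * s) * (1 - r)\<^sup>2) \<le> 0"
    using \<mu> by (simp add: mult_le_0_iff)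
  moreover have "2 * t * \<mu> * r\<^sup>2 - (1 - 2 * t) * (a * r\<^sup>2) + \<kappa> * a
      + \<mu> * ((1 + \<kappa>) * r\<^sup>2 - \<kappa> + \<kappa> * (1 + \<kappa>) * (1 - r)\<^sup>2) - \<mu> =
      \<mu> * (\<alpha> * b + (2 - s) * u - 2 * (1 - s) + 2 * (1 - s) * (1 - 2 * s) * (1 - r)\<^sup>2)"
    unfolding \<alpha>(2) u_def[symmetric] b_def \<kappa>_def s_def by (simp add: algebra_simps)
  ultimately show ?thesis by linarith
qed

section \<open>Eigenvalues of one corrected half of the sum\<close>

text \<open>
  In an eigenbasis of \<open>M\<close> the claim is coordinatewise. Where \<open>m > \<mu>\<close> the vector \<open>v\<close> has no
  component; the left side is then nonpositive and the right side nonnegative. Where \<open>m \<le> \<mu>\<close>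
  the two sides differ by nonnegative multiples of \<open>\<mu> - m\<close> and \<open>m\<close>, by the inequality
  \<open>\<kappa> \<bar>w\<bar>\<^sup>2 \<le> (1 + \<kappa>) \<bar>v\<bar>\<^sup>2 + \<kappa> (1 + \<kappa>) \<bar>w - v\<bar>\<^sup>2\<close>.
\<close>

lemma qform_spectral_cutoff_bound:
  fixes V :: "complex^'n^'n"
  assumes V: "unitary_matrix V" and m: "\<And>i. 0 \<le> m $ i" and \<kappa>: "0 \<le> \<kappa>" and \<mu>: "0 < \<mu>"
    and v: "\<And>i. \<mu> < m $ i \<Longrightarrow> (ctranspose V *v v) $ i = 0"
  defines "M \<equiv> V ** diag_matrix m ** ctranspose V"
  shows "(1 + \<kappa>) * qform M v - \<kappa> * qform M w
    \<le> \<mu> * ((1 + \<kappa>) * (norm v)\<^sup>2 - \<kappa> * (norm w)\<^sup>2 + \<kappa> * (1 + \<kappa>) * (norm (w - v))\<^sup>2)"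
proof -
  define v' w' where "v' = ctranspose V *v v" and "w' = ctranspose V *v w"
  have pt: "m $ i * ((1 + \<kappa>) * (cmod (v' $ i))\<^sup>2 - \<kappa> * (cmod (w' $ i))\<^sup>2)
      \<le> \<mu> * ((1 + \<kappa>) * (cmod (v' $ i))\<^sup>2 - \<kappa> * (cmod (w' $ i))\<^sup>2 + \<kappa> * (1 + \<kappa>) * (cmod (w' $ i - v' $ i))\<^sup>2)" for i
  proof (cases "\<mu> < m $ i")
    case True
    then have "v' $ i = 0" using v by (simp add: v'_def)
    moreover have "m $ i * (\<kappa> * (cmod (w' $ i))\<^sup>2) \<ge> 0" "\<mu> * (\<kappa> * \<kappa> * (cmod (w' $ i))\<^sup>2) \<ge> 0"
      using m[of i] \<kappa> \<mu> by auto
    ultimately show ?thesis by (simp add: algebra_simps)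
  next
    case False
    define p q where "p = cmod (v' $ i)" and "q = cmod (w' $ i - v' $ i)"
    have "cmod (w' $ i) \<le> p + q"
      unfolding p_def q_def using norm_triangle_ineq[of "v' $ i" "w' $ i - v' $ i"] by simp
    then have "(cmod (w' $ i))\<^sup>2 \<le> (p + q)\<^sup>2"
      by (intro power_mono) auto
    then have "\<kappa> * (cmod (w' $ i))\<^sup>2 \<le> \<kappa> * (p + q)\<^sup>2"
      using \<kappa> by (rule mult_left_mono)
    moreover have "(1 + \<kappa>) * p\<^sup>2 + \<kappa> * (1 + \<kappa>) * q\<^sup>2 - \<kappa> * (p + q)\<^sup>2 = (p - \<kappa> * q)\<^sup>2"
      by (simp add: power2_eq_square algebra_simps)
    ultimately have "0 \<le> (1 + \<kappa>) * p\<^sup>2 - \<kappa> * (cmod (w' $ i))\<^sup>2 + \<kappa> * (1 + \<kappa>) * q\<^sup>2"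
      using zero_le_power2[of "p - \<kappa> * q"] by linarith
    then have "0 \<le> (\<mu> - m $ i) * ((1 + \<kappa>) * p\<^sup>2 - \<kappa> * (cmod (w' $ i))\<^sup>2 + \<kappa> * (1 + \<kappa>) * q\<^sup>2)"
      using False by (intro mult_nonneg_nonneg) auto
    moreover have "0 \<le> m $ i * (\<kappa> * (1 + \<kappa>) * q\<^sup>2)"
      using m[of i] \<kappa> by auto
    ultimately show ?thesis
      unfolding p_def[symmetric] q_def[symmetric] by (simp add: algebra_simps)
  qed
  have norms: "(norm v)\<^sup>2 = (\<Sum>i\<in>UNIV. (cmod (v' $ i))\<^sup>2)" "(norm w)\<^sup>2 = (\<Sum>i\<in>UNIV. (cmod (w' $ i))\<^sup>2)"
    "(norm (w - v))\<^sup>2 = (\<Sum>i\<in>UNIV. (cmod (w' $ i - v' $ i))\<^sup>2)"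
    using unitary_norm[OF unitary_adjoint[OF V], of v] unitary_norm[OF unitary_adjoint[OF V], of w]
      unitary_norm[OF unitary_adjoint[OF V], of "w - v"]
    by (simp_all add: norm_power2_sum[symmetric] v'_def w'_def matrix_vector_mult_diff_distrib
       vector_minus_component[symmetric] del: vector_minus_component)
  have "(1 + \<kappa>) * qform M v - \<kappa> * qform M w =
      (\<Sum>i\<in>UNIV. m $ i * ((1 + \<kappa>) * (cmod (v' $ i))\<^sup>2 - \<kappa> * (cmod (w' $ i))\<^sup>2))"
    unfolding M_def qform_diagonalized v'_def[symmetric] w'_def[symmetric]
    by (simp add: sum_distrib_left sum_subtractf[symmetric] algebra_simps)
  also have "\<dots> \<le> (\<Sum>i\<in>UNIV. \<mu> * ((1 + \<kappa>) * (cmod (v' $ i))\<^sup>2 - \<kappa> * (cmod (w' $ i))\<^sup>2 + \<kappa> * (1 + \<kappa>) * (cmod (w' $ i - v' $ i))\<^sup>2))"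
    by (rule sum_mono) (rule pt)
  also have "\<dots> = \<mu> * ((1 + \<kappa>) * (norm v)\<^sup>2 - \<kappa> * (norm w)\<^sup>2 + \<kappa> * (1 + \<kappa>) * (norm (w - v))\<^sup>2)"
    unfolding norms by (simp add: sum_distrib_left sum_subtractf sum.distrib algebra_simps)
  finally show ?thesis .
qed

lemma qform_powr_le_tangent:
  assumes y: "psd_matrix y" and \<mu>: "0 < \<mu>" and q: "0 < q" "q \<le> 1"
  shows "qform (matrix_powr y q) v \<le> \<mu> powr (q - 1) * ((1 - q) * \<mu> * (norm v)\<^sup>2 + q * qform y v)"
proof -
  obtain U b where U: "unitary_matrix U" and b: "\<And>i. 0 \<le> b $ i" and y_eq: "y = U ** diag_matrix b ** ctranspose U"
    using psd_diagonalizable[OF y] by blast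
  define w where "w = ctranspose U *v v"
  have "qform (matrix_powr y q) v = (\<Sum>i\<in>UNIV. b $ i powr q * (cmod (w $ i))\<^sup>2)"
    using q by (simp add: y_eq matrix_powr_diagonalized[OF U] qform_diagonalized w_def)
  also have "\<dots> \<le> (\<Sum>i\<in>UNIV. \<mu> powr (q - 1) * ((1 - q) * \<mu> + q * b $ i) * (cmod (w $ i))\<^sup>2)"
    by (intro sum_mono mult_right_mono powr_le_tangent b \<mu> q) simp
  also have "\<dots> = \<mu> powr (q - 1) * ((1 - q) * \<mu> * (\<Sum>i\<in>UNIV. (cmod (w $ i))\<^sup>2) + q * qform y v)"
    unfolding y_eq qform_diagonalized w_def[symmetric] sum_distrib_left sum.distrib[symmetric]
    by (intro sum.cong refl) (simp add: algebra_simps)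
  also have "(\<Sum>i\<in>UNIV. (cmod (w $ i))\<^sup>2) = (norm v)\<^sup>2"
    using unitary_norm[OF unitary_adjoint[OF U], of v] by (simp add: norm_power2_sum[symmetric] w_def)
  finally show ?thesis .
qed

text \<open>
  The heart of the proof. The power of \<open>y\<close> is bounded by its tangent at \<open>\<mu>\<close>, which makes the
  form linear in \<open>y = 2 M - x\<close>. What involves \<open>M\<close> is
  \<open>(1 + \<kappa>) \<langle>v, M v\<rangle> - \<kappa> \<langle>w, M w\<rangle>\<close> with \<open>\<kappa> = 1 - 4 t\<close>, where \<open>v\<close> is \<open>x powr t\<close> applied to
  \<open>w\<close> and rescaled; the assumption on \<open>w\<close> says exactly that \<open>v\<close> lives where \<open>M \<le> \<mu>\<close>,
  so \<open>qform_spectral_cutoff_bound\<close> applies. The right side is then diagonal in an eigenbasis of \<open>x\<close>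
  and each coordinate is an instance of \<open>corrected_half_scalar_inequality\<close>. The restriction \<open>t \<le> 1/4\<close>
  is what makes \<open>\<kappa>\<close> nonnegative.
\<close>

lemma qform_corrected_half_le:
  fixes x y :: "complex^'n^'n"
  assumes x: "psd_matrix x" and y: "psd_matrix y" and t: "0 < t" "t \<le> 1/4" and \<mu>: "0 < \<mu>"
    and V: "unitary_matrix V" and m: "\<And>i. 0 \<le> m $ i"
    and M: "(1/2) *\<^sub>R (x + y) = V ** diag_matrix m ** ctranspose V"
    and w: "\<And>i. \<mu> < m $ i \<Longrightarrow> (ctranspose V *v (matrix_powr x t *v w)) $ i = 0"
  shows "qform (matrix_powr x t ** matrix_powr y (1 - 2 * t) ** matrix_powr x t + (1/2 - 2 * t) *\<^sub>R (x - y)) w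
    \<le> \<mu> * (norm w)\<^sup>2"
proof -
  obtain U a where U: "unitary_matrix U" and a: "\<And>i. 0 \<le> a $ i" and x_eq: "x = U ** diag_matrix a ** ctranspose U"
    using psd_diagonalizable[OF x] by blast
  define c where "c = matrix_powr x t"
  define M where "M = (1/2) *\<^sub>R (x + y)"
  define \<kappa> where "\<kappa> = 1 - 4 * t"
  have \<kappa>: "0 \<le> \<kappa>" using t by (simp add: \<kappa>_def)
  \<comment> \<open>scaled so that \<open>v = w\<close> when \<open>x = \<mu> I\<close>; then \<open>w - v\<close> is small near the extremal case\<close>
  define v where "v = \<mu> powr (- t) *\<^sub>R (c *v w)"
  define \<omega> where "\<omega> = ctranspose U *v w"
  define r where "r i = (a $ i / \<mu>) powr t" for i
  have M_eq: "qform M z = (qform x z + qform y z) / 2" for z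
    by (simp add: M_def qform_scaleR_matrix qform_add)
  have Uv: "(ctranspose U *v v) $ i = r i * \<omega> $ i" for i
  proof -
    have "ctranspose U *v (c *v w) = diag_matrix (\<chi> i. a $ i powr t) *v \<omega>"
    proof -
      have "ctranspose U *v (c *v w) = (ctranspose U ** U) ** diag_matrix (\<chi> i. a $ i powr t) ** ctranspose U *v w"
        using t by (simp add: c_def x_eq matrix_powr_diagonalized[OF U] matrix_vector_mul_assoc matrix_mul_assoc)
      then show ?thesis
        using U by (simp add: \<omega>_def matrix_vector_mul_assoc unitary_matrix_def)
    qed
    moreover have "(diag_matrix d *v \<omega>) $ i = d $ i * \<omega> $ i" for d
      by (simp add: matrix_vector_mult_def diag_matrix_def if_distrib[where f="\<lambda>x. x * _"] cong: if_cong)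
    ultimately have "(ctranspose U *v v) $ i = \<mu> powr (- t) *\<^sub>R (a $ i powr t * \<omega> $ i)"
      by (simp add: v_def matrix_vector_scaleR)
    also have "\<dots> = (\<mu> powr (- t) * a $ i powr t) * \<omega> $ i"
      by (simp add: scaleR_conv_of_real)
    also have "\<mu> powr (- t) * a $ i powr t = r i"
      using a[of i] \<mu> by (simp add: r_def powr_divide powr_minus field_simps)
    finally show ?thesis .
  qed
  have qx: "qform x w = (\<Sum>i\<in>UNIV. a $ i * (cmod (\<omega> $ i))\<^sup>2)"
    "qform x v = (\<Sum>i\<in>UNIV. a $ i * (r i)\<^sup>2 * (cmod (\<omega> $ i))\<^sup>2)"
    by (simp_all add: x_eq qform_diagonalized \<omega>_def[symmetric] Uv norm_mult power_mult_distrib algebra_simps)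
  have nw: "(norm w)\<^sup>2 = (\<Sum>i\<in>UNIV. (cmod (\<omega> $ i))\<^sup>2)"
    using unitary_norm[OF unitary_adjoint[OF U], of w] by (simp add: norm_power2_sum[symmetric] \<omega>_def)
  have nv: "(norm v)\<^sup>2 = (\<Sum>i\<in>UNIV. (r i)\<^sup>2 * (cmod (\<omega> $ i))\<^sup>2)"
  proof -
    have "(norm v)\<^sup>2 = (norm (ctranspose U *v v))\<^sup>2"
      using unitary_norm[OF unitary_adjoint[OF U], of v] by simp
    then show ?thesis by (simp add: norm_power2_sum Uv norm_mult power_mult_distrib)
  qed
  have nd: "(norm (w - v))\<^sup>2 = (\<Sum>i\<in>UNIV. (1 - r i)\<^sup>2 * (cmod (\<omega> $ i))\<^sup>2)"
  proof -
    have "(ctranspose U *v (w - v)) $ i = complex_of_real (1 - r i) * \<omega> $ i" for i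
      by (simp add: matrix_vector_mult_diff_distrib Uv \<omega>_def[symmetric] left_diff_distrib)
    then have "(norm (ctranspose U *v (w - v)))\<^sup>2 = (\<Sum>i\<in>UNIV. (1 - r i)\<^sup>2 * (cmod (\<omega> $ i))\<^sup>2)"
      by (simp only: norm_power2_sum norm_mult norm_of_real power_mult_distrib power2_abs)
    then show ?thesis using unitary_norm[OF unitary_adjoint[OF U], of "w - v"] by simp
  qed
  have "qform (c ** matrix_powr y (1 - 2 * t) ** c) w = qform (matrix_powr y (1 - 2 * t)) (c *v w)"
    using qform_conj[of c "matrix_powr y (1 - 2 * t)" w] hermitian_matrix_powr[OF x, of t] t
    by (simp add: c_def)
  also have "\<dots> \<le> \<mu> powr (- (2 * t)) * (2 * t * \<mu> * (norm (c *v w))\<^sup>2 + (1 - 2 * t) * qform y (c *v w))"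
    using qform_powr_le_tangent[OF y \<mu>, of "1 - 2 * t" "c *v w"] t by simp
  also have "\<dots> = 2 * t * \<mu> * (norm v)\<^sup>2 + (1 - 2 * t) * qform y v"
  proof -
    have sq: "(\<mu> powr (- t))\<^sup>2 = \<mu> powr (- (2 * t))"
      by (simp add: power2_eq_square powr_add[symmetric])
    show ?thesis
      by (simp add: v_def qform_scaleR power_mult_distrib sq algebra_simps)
  qed
  finally have "qform (c ** matrix_powr y (1 - 2 * t) ** c + (1/2 - 2 * t) *\<^sub>R (x - y)) w
      \<le> 2 * t * \<mu> * (norm v)\<^sup>2 + (1 - 2 * t) * qform y v + (1/2 - 2 * t) * (qform x w - qform y w)"
    by (simp add: qform_add qform_scaleR_matrix qform_diff)
  also have "\<dots> = 2 * t * \<mu> * (norm v)\<^sup>2 - (1 - 2 * t) * qform x v + \<kappa> * qform x w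
      + ((1 + \<kappa>) * qform M v - \<kappa> * qform M w)"
    by (simp add: M_eq \<kappa>_def field_simps)
  also have "\<dots> \<le> 2 * t * \<mu> * (norm v)\<^sup>2 - (1 - 2 * t) * qform x v + \<kappa> * qform x w
      + \<mu> * ((1 + \<kappa>) * (norm v)\<^sup>2 - \<kappa> * (norm w)\<^sup>2 + \<kappa> * (1 + \<kappa>) * (norm (w - v))\<^sup>2)"
    unfolding M_def M using w
    by (intro add_left_mono qform_spectral_cutoff_bound[OF V m \<kappa> \<mu>])
      (simp add: v_def c_def matrix_vector_scaleR)
  also have "\<dots> = (\<Sum>i\<in>UNIV. (2 * t * \<mu> * (r i)\<^sup>2 - (1 - 2 * t) * (a $ i * (r i)\<^sup>2) + \<kappa> * a $ i
      + \<mu> * ((1 + \<kappa>) * (r i)\<^sup>2 - \<kappa> + \<kappa> * (1 + \<kappa>) * (1 - r i)\<^sup>2)) * (cmod (\<omega> $ i))\<^sup>2)"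
    unfolding qx nw nv nd sum_distrib_left sum_subtractf[symmetric] sum.distrib[symmetric]
    by (intro sum.cong refl) (simp add: algebra_simps)
  also have "\<dots> \<le> (\<Sum>i\<in>UNIV. \<mu> * (cmod (\<omega> $ i))\<^sup>2)"
    unfolding r_def \<kappa>_def
    by (intro sum_mono mult_right_mono corrected_half_scalar_inequality a \<mu> t) simp
  also have "\<dots> = \<mu> * (norm w)\<^sup>2"
    by (simp add: nw sum_distrib_left)
  finally show ?thesis by (simp add: c_def)
qed

text \<open>
  Domination of the sorted eigenvalues of one Hermitian matrix by those of another is
  domination in the Loewner order up to a unitary conjugation. The correction
  \<open>(1/2 - 2 t) (x - y)\<close> is the one for which, in the scalar case, Young's inequality becomes
  \<open>x powr (2 t) y powr (1 - 2 t) + (1/2 - 2 t) (x - y) \<le> (x + y) / 2\<close>. It is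
  antisymmetric in \<open>x\<close> and \<open>y\<close> and therefore disappears from the sum of the two halves.
\<close>

theorem corrected_half_le_unitary_conj:
  fixes x y :: "complex^'n^'n"
  assumes x: "psd_matrix x" and y: "psd_matrix y" and t: "0 < t" "t \<le> 1/4"
  obtains K where "unitary_matrix K"
    "\<And>v. qform (matrix_powr x t ** matrix_powr y (1 - 2 * t) ** matrix_powr x t + (1/2 - 2 * t) *\<^sub>R (x - y)) v
      \<le> qform (K ** ((1/2) *\<^sub>R (x + y)) ** ctranspose K) v"
proof -
  define G where "G = matrix_powr x t ** matrix_powr y (1 - 2 * t) ** matrix_powr x t + (1/2 - 2 * t) *\<^sub>R (x - y)"
  have "psd_matrix ((1/2) *\<^sub>R (x + y))"
    using x y by (intro psd_scaleR psd_add) auto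
  then obtain V m where V: "unitary_matrix V" and m: "\<And>i. 0 \<le> m $ i"
    and M: "(1/2) *\<^sub>R (x + y) = V ** diag_matrix m ** ctranspose V"
    using psd_diagonalizable by blast
  have "hermitian_matrix (matrix_powr y (1 - 2 * t))"
    using hermitian_matrix_powr[OF y, of "1 - 2 * t"] t by (simp add: hermitian_matrix_def)
  then have "hermitian_matrix (matrix_powr x t ** matrix_powr y (1 - 2 * t) ** matrix_powr x t)"
    using hermitian_conj[of "matrix_powr y (1 - 2 * t)" "matrix_powr x t"] hermitian_matrix_powr[OF x, of t] t by simp
  then have "hermitian_matrix G"
    unfolding G_def
    by (intro hermitian_add hermitian_scaleR hermitian_diff psd_hermitian[OF x] psd_hermitian[OF y])
  then obtain U g where U: "unitary_matrix U" and G: "G = U ** diag_matrix g ** ctranspose U"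
    using hermitian_diagonalizable by blast
  have le: "qform (U ** diag_matrix g ** ctranspose U) w \<le> \<mu> * (norm w)\<^sup>2"
    if "0 < \<mu>" "\<And>i. \<mu> < m $ i \<Longrightarrow> (ctranspose V *v (matrix_powr x t *v w)) $ i = 0" for \<mu> w
    unfolding G[symmetric] G_def by (rule qform_corrected_half_le[OF x y t that(1) V m M that(2)])
  obtain \<pi> :: "'n \<Rightarrow> 'n" where \<pi>: "bij \<pi>" "\<And>i. g $ i \<le> m $ \<pi> i"
    using eigenvalues_dominated[OF U m le] by metis
  define P :: "complex^'n^'n" where "P = permutation_matrix \<pi>"
  define K where "K = U ** P ** ctranspose V"
  have K: "unitary_matrix K"
    unfolding K_def P_def by (intro unitary_mult unitary_adjoint U V unitary_permutation_matrix \<pi>)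
  have "K ** ((1/2) *\<^sub>R (x + y)) ** ctranspose K =
      U ** P ** (ctranspose V ** V) ** diag_matrix m ** (ctranspose V ** V) ** ctranspose P ** ctranspose U"
    unfolding M K_def by (simp add: ctranspose_mult matrix_mul_assoc)
  also have "\<dots> = U ** P ** mat 1 ** diag_matrix m ** mat 1 ** ctranspose P ** ctranspose U"
    using V by (simp only: unitary_matrix_def)
  also have "\<dots> = U ** (P ** diag_matrix m ** ctranspose P) ** ctranspose U"
    by (simp add: matrix_mul_assoc)
  also have "\<dots> = U ** diag_matrix (\<chi> i. m $ \<pi> i) ** ctranspose U"
    by (simp add: P_def permutation_matrix_conj_diag[OF \<pi>(1)])
  finally have KM: "K ** ((1/2) *\<^sub>R (x + y)) ** ctranspose K = U ** diag_matrix (\<chi> i. m $ \<pi> i) ** ctranspose U" .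
  have "qform G v \<le> qform (K ** ((1/2) *\<^sub>R (x + y)) ** ctranspose K) v" for v
    unfolding G KM qform_diagonalized by (intro sum_mono mult_right_mono) (auto simp: \<pi>(2))
  then show thesis using that K by (simp add: G_def)
qed

section \<open>The norm inequality\<close>

text \<open>
  Both products are treated at once because the second matrix is the adjoint of the first, and
  the bound is proved for their common positive polar factor \<open>X\<close>.
\<close>

theorem norm_symmetrized_product_le:
  fixes x y :: "complex^'n^'n"
  assumes x: "psd_matrix x" and y: "psd_matrix y" and N: "unitarily_invariant_norm N"
    and t: "0 < t" "t \<le> 1/4"
  shows "N (matrix_powr x t ** matrix_powr y (1 - t) + matrix_powr y t ** matrix_powr x (1 - t)) \<le> N (x + y)"
    and "N (matrix_powr y (1 - t) ** matrix_powr x t + matrix_powr x (1 - t) ** matrix_powr y t) \<le> N (x + y)"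
proof -
  define T where "T = matrix_powr x t ** matrix_powr y (1 - t) + matrix_powr y t ** matrix_powr x (1 - t)"
  define M where "M = (1/2) *\<^sub>R (x + y)"
  define S where "S x y = matrix_powr x t ** matrix_powr y (1 - 2 * t) ** matrix_powr x t" for x y :: "complex^'n^'n"
  have M: "psd_matrix M"
    unfolding M_def using x y by (intro psd_scaleR psd_add) auto
  obtain K where K: "unitary_matrix K"
    "\<And>v. qform (S x y + (1/2 - 2 * t) *\<^sub>R (x - y)) v \<le> qform (K ** M ** ctranspose K) v"
    using corrected_half_le_unitary_conj[OF x y t] unfolding S_def M_def by blast
  obtain L where L: "unitary_matrix L"
    "\<And>v. qform (S y x + (1/2 - 2 * t) *\<^sub>R (y - x)) v \<le> qform (L ** M ** ctranspose L) v"
    using corrected_half_le_unitary_conj[OF y x t] unfolding S_def M_def add.commute[of y x] by blast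
  \<comment> \<open>the corrections cancel in the sum\<close>
  have S_le: "qform (S x y) v + qform (S y x) v \<le> qform M (ctranspose K *v v) + qform M (ctranspose L *v v)" for v
    using K(2)[of v] L(2)[of v]
    by (simp add: qform_add qform_scaleR_matrix qform_diff qform_conj algebra_simps)
  obtain W X where W: "unitary_matrix W" and X: "psd_matrix X" and T: "T = W ** X"
    using polar_decomposition by blast
  \<comment> \<open>Cauchy--Schwarz and the arithmetic-geometric mean inequality after splitting
    the exponent \<open>1 - t\<close> as \<open>(1/2 - t) + 1/2\<close>\<close>
  have half: "Re (cinner z (matrix_powr a t ** matrix_powr b (1 - t) *v v)) \<le> (qform (S a b) z + qform b v) / 2"
    if a: "psd_matrix a" and b: "psd_matrix b" for a b z v
  proof -
    define p where "p = matrix_powr b (1/2 - t) *v (matrix_powr a t *v z)"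
    define q where "q = matrix_powr b (1/2) *v v"
    have adj: "cinner p v' = cinner z (matrix_powr a t *v (matrix_powr b (1/2 - t) *v v'))" for v'
      using hermitian_matrix_powr[OF a, of t] hermitian_matrix_powr[OF b, of "1/2 - t"] t
      by (simp add: p_def cinner_adjoint del: matrix_vector_mul_assoc)
    have "matrix_powr b (1/2 - t) ** matrix_powr b (1/2) = matrix_powr b (1 - t)"
      using matrix_powr_add[OF b, of "1/2 - t" "1/2"] t by simp
    then have "cinner p q = cinner z (matrix_powr a t ** matrix_powr b (1 - t) *v v)"
      by (simp add: adj q_def matrix_vector_mul_assoc flip: matrix_mul_assoc)
    moreover have "Re (cinner p q) \<le> ((norm p)\<^sup>2 + (norm q)\<^sup>2) / 2"
    proof -
      have "0 \<le> (norm (p - q))\<^sup>2" by simp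
      also have "(norm (p - q))\<^sup>2 = Re (cinner (p - q) (p - q))"
        by (simp add: cinner_self del: of_real_power)
      also have "\<dots> = Re (cinner p p) - Re (cinner p q) - Re (cinner q p) + Re (cinner q q)"
        by (simp add: cinner_diff_left cinner_diff_right)
      also have "Re (cinner q p) = Re (cinner p q)"
        by (subst cinner_commute) simp
      finally show ?thesis by (simp add: cinner_self del: of_real_power)
    qed
    moreover have "(norm p)\<^sup>2 = qform (S a b) z"
    proof -
      have "matrix_powr b (1/2 - t) ** matrix_powr b (1/2 - t) = matrix_powr b (1 - 2 * t)"
        using matrix_powr_add[OF b, of "1/2 - t" "1/2 - t"] t by simp
      then have "matrix_powr b (1/2 - t) *v p = matrix_powr b (1 - 2 * t) *v (matrix_powr a t *v z)"
        by (simp add: p_def matrix_vector_mul_assoc matrix_mul_assoc)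
      then have "cinner p p = cinner z (S a b *v z)"
        by (simp add: adj S_def matrix_vector_mul_assoc matrix_mul_assoc)
      then show ?thesis unfolding qform_def by (metis Re_complex_of_real cinner_self)
    qed
    moreover have "(norm q)\<^sup>2 = qform b v"
    proof -
      have "cinner q q = cinner v (b *v v)"
        using hermitian_matrix_powr[OF b, of "1/2"] matrix_powr_add[OF b, of "1/2" "1/2"]
        by (simp add: q_def cinner_adjoint matrix_vector_mul_assoc matrix_powr_1[OF b])
      then show ?thesis unfolding qform_def by (metis Re_complex_of_real cinner_self)
    qed
    ultimately show ?thesis by simp
  qed
  define Z where "Z = (1/2) *\<^sub>R (ctranspose W ** K ** M ** ctranspose (ctranspose W ** K))
    + (1/2) *\<^sub>R (ctranspose W ** L ** M ** ctranspose (ctranspose W ** L)) + M"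
  have Z: "psd_matrix Z"
    unfolding Z_def by (intro psd_add psd_scaleR psd_conj M) auto
  have X_le: "qform X v \<le> qform Z v" for v
  proof -
    define z where "z = W *v v"
    have "X = ctranspose W ** T"
      using W by (simp add: T matrix_mul_assoc unitary_matrix_def)
    then have "qform X v = Re (cinner z (T *v v))"
      by (simp add: qform_def z_def cinner_adjoint matrix_vector_mul_assoc)
    also have "\<dots> = Re (cinner z (matrix_powr x t ** matrix_powr y (1 - t) *v v)) +
        Re (cinner z (matrix_powr y t ** matrix_powr x (1 - t) *v v))"
      by (simp add: T_def matrix_vector_mult_add_rdistrib cinner_add_right)
    also have "\<dots> \<le> (qform (S x y) z + qform y v) / 2 + (qform (S y x) z + qform x v) / 2"
      by (intro add_mono half x y)
    also have "\<dots> \<le> (qform M (ctranspose K *v z) + qform M (ctranspose L *v z)) / 2 + qform M v"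
      using S_le[of z] by (simp add: M_def qform_scaleR_matrix qform_add field_simps)
    also have "\<dots> = qform Z v"
      unfolding Z_def qform_add qform_scaleR_matrix qform_conj
      by (simp add: ctranspose_mult z_def matrix_vector_mul_assoc add_divide_distrib)
    finally show ?thesis .
  qed
  have "N X \<le> N Z"
    by (rule unitarily_invariant_norm_psd_mono[OF N X Z X_le])
  also have "N Z \<le> N M / 2 + N M / 2 + N M"
  proof -
    have "N ((1/2) *\<^sub>R (ctranspose W ** J ** M ** ctranspose (ctranspose W ** J))) = N M / 2"
      if "unitary_matrix J" for J
      by (simp add: unitarily_invariant_norm_scaleR[OF N]
          unitarily_invariant_norm_conj[OF N unitary_mult[OF unitary_adjoint[OF W] that]])
    then show ?thesis
      unfolding Z_def using K(1) L(1)
      by (smt (verit) unitarily_invariant_norm_triangle[OF N])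
  qed
  also have "\<dots> = N (x + y)"
    by (simp add: M_def unitarily_invariant_norm_scaleR[OF N])
  finally have N_X: "N X \<le> N (x + y)" .
  then show "N (matrix_powr x t ** matrix_powr y (1 - t) + matrix_powr y t ** matrix_powr x (1 - t)) \<le> N (x + y)"
    using unitarily_invariant_norm_left[OF N W] by (simp add: T_def[symmetric] T)
  have "matrix_powr y (1 - t) ** matrix_powr x t + matrix_powr x (1 - t) ** matrix_powr y t = ctranspose T"
    using hermitian_matrix_powr[OF x, of t] hermitian_matrix_powr[OF x, of "1 - t"]
      hermitian_matrix_powr[OF y, of t] hermitian_matrix_powr[OF y, of "1 - t"] t
    by (simp add: T_def ctranspose_add ctranspose_mult)
  also have "\<dots> = X ** ctranspose W"
    using psd_hermitian[OF X] by (simp add: T ctranspose_mult hermitian_matrix_def)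
  finally show "N (matrix_powr y (1 - t) ** matrix_powr x t + matrix_powr x (1 - t) ** matrix_powr y t) \<le> N (x + y)"
    using N_X unitarily_invariant_norm_right[OF N unitary_adjoint[OF W]] by simp
qed

theorem proposition3p3:
  fixes x y :: "complex^'n^'n"
    and N :: "complex^'n^'n \<Rightarrow> real"
    and t :: real
  assumes "psd_matrix x"
    and "psd_matrix y"
    and "unitarily_invariant_norm N"
    and "t \<in> {0..1/4} \<union> {3/4..1}"
  shows "N (matrix_powr x t ** matrix_powr y (1 - t) + matrix_powr y t ** matrix_powr x (1 - t))
    \<le> N (x + y)"
proof -
  consider "t = 0" | "t = 1" | "0 < t" "t \<le> 1/4" | "0 < 1 - t" "1 - t \<le> 1/4"
    using assms(4) by fastforce
  then show ?thesis
  proof cases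
    case 1
    then show ?thesis
      using assms(1,2) by (simp add: matrix_powr_0 matrix_powr_1 add.commute)
  next
    case 2
    then show ?thesis
      using assms(1,2) by (simp add: matrix_powr_0 matrix_powr_1)
  next
    case 3
    then show ?thesis using norm_symmetrized_product_le(1)[OF assms(1-3)] by simp
  next
    case 4
    then show ?thesis
      using norm_symmetrized_product_le(2)[OF assms(1-3), of "1 - t"] by (simp add: add.commute)
  qed
qed

end
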